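(* Let $n\ge 3$. Let $Q\colon[0,\infty)\to(0,\infty)$ be monotone increasing with $r^{2}<Q(r)$ for all $r$. Let $m\in\mathbb{N}=\{1,2,\dots\}$, $k>1$ and $R_m>0$ be such that (i) $Q$ is differentiable in $(R_m,\infty)$; (ii) for all $r\ge R_m$: $\ln^{(m)}\left(\int_0^r Q(t)^{1/2}\,\mathrm{d}t\right)>0$; (iii) for all $r\ge R_m$: $0<f_{k,m-1}\left(\ln(Q(r))\right)\,r\,Q(r)^{-1/2}<1$. Assume moreover that $Q'(r)Q(r)^{-3/2}\to 0$ as $r\to\infty$, and let $d\in(0,1]$. Then for every continuous potential $q\colon\mathbb{R}^n\to[0,\infty)$ satisfying $$d\left(\int_0^{|x|}Q(t)^{1/2}\,\mathrm{d}t\right) f_{k,m-1}\left(\ln\left(\int_0^{|x|}Q(t)^{1/2}\,\mathrm{d}t\right)\right)\le q(x)\le Q(|x|)\qquad\text{for } |x|\ge R_m,$$ the ground state $\varphi$ of $H=-\Delta+q(x)$ satisfies Rosen inequalities, i.e. for every $\varepsilon>0$ there exists $\gamma(\varepsilon)>0$ such that for all $x\in\mathbb{R}^n$ $$-\ln(\varphi(x))\le\varepsilon q(x)+\gamma(\varepsilon).$$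
   Context: Iterated logarithms: $\ln^{(0)}(t)=t$ and $\ln^{(p)}(t)=\ln(\ln(\dots\ln(t)\dots))$ ($p$ times). For $k>1$ and an integer $j\ge 0$, $f_{k,j}(t)=\left(\ln^{(j)}(t)\right)^{k}\prod_{p=0}^{j-1}\ln^{(p)}(t)$ for all $t$ large enough that $\ln^{(j)}(t)$ is defined and positive (so $f_{k,0}(t)=t^k$, with empty product equal to $1$). Schrödinger operator and ground state: for a continuous $q\colon\mathbb{R}^n\to[0,\infty)$ with $q(x)\to\infty$ as $|x|\to\infty$ (the potentials in the theorem have this property), let $D(h)=\{u\in H^1(\mathbb{R}^n): q^{1/2}u\in L^2(\mathbb{R}^n)\}$ and $h(u,v)=\sum_{j=1}^n\langle\partial_j u,\partial_j v\rangle+\langle q^{1/2}u,q^{1/2}v\rangle$, where $\langle\cdot,\cdot\rangle$ is the $L^2(\mathbb{R}^n)$ inner product (complex-valued functions). $H=-\Delta+q(x)$ is the self-adjoint operator in $L^2(\mathbb{R}^n)$ associated with $h$: $D(H)=\{u\in D(h):\exists v\in L^2(\mathbb{R}^n)\ \forall w\in D(h):\ h(u,w)=\langle v,w\rangle\}$, $Hu=v$. Its spectrum consists only of eigenvalues; $E_0=\min\sigma(H)\ge 0$ is a simple eigenvalue with an eigenfunction $\varphi$ that is strictly positive almost everywhere, normalized by $\|\varphi\|_2=1$; $\varphi$ is called the ground state. It has a continuous representative which is strictly positive everywhere, and $\varphi$ denotes this representative. *)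

theory Defs
  imports "HOL-Analysis.Analysis"
begin

(* f_log k j t is meaningful only if ln^(j) t is defined and positive, i.e. (see iter_ln_pos)
   if (ln ^^ p) t > 0 for all p <= j; elsewhere the value is junk, as ln is total in HOL. *)
definition f_log :: "real \<Rightarrow> nat \<Rightarrow> real \<Rightarrow> real" where
  "f_log k j t = ((ln ^^ j) t) powr k * (\<Prod>p<j. (ln ^^ p) t)"

(* "ln^(j) t is defined and positive": the intermediate iterates must be positive as well,
   since the total ln of HOL also takes values at nonpositive arguments. *)
definition iter_ln_pos :: "nat \<Rightarrow> real \<Rightarrow> bool" where
  "iter_ln_pos j t \<longleftrightarrow> (\<forall>p\<le>j. (ln ^^ p) t > 0)"

(* Elements of L^2 are represented by Borel functions; equality in L^2 is equality a.e. *)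
definition L2 :: "((real ^ 'n) \<Rightarrow> complex) set" where
  "L2 = {u. u \<in> borel_measurable borel \<and> integrable lborel (\<lambda>x. (norm (u x))\<^sup>2)}"

definition L2_inner :: "((real ^ 'n) \<Rightarrow> complex) \<Rightarrow> ((real ^ 'n) \<Rightarrow> complex) \<Rightarrow> complex" where
  "L2_inner u v = (LINT x|lborel. u x * cnj (v x))"

definition L2_norm :: "((real ^ 'n) \<Rightarrow> complex) \<Rightarrow> real" where
  "L2_norm u = sqrt (LINT x|lborel. (norm (u x))\<^sup>2)"

definition partial :: "'n \<Rightarrow> ((real ^ 'n) \<Rightarrow> complex) \<Rightarrow> (real ^ 'n) \<Rightarrow> complex" where
  "partial i f x = frechet_derivative f (at x) (axis i 1)"

primrec Ck :: "nat \<Rightarrow> ((real ^ 'n) \<Rightarrow> complex) \<Rightarrow> bool" where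
  "Ck 0 f \<longleftrightarrow> continuous_on UNIV f"
| "Ck (Suc k) f \<longleftrightarrow> (\<forall>x. f differentiable (at x)) \<and> (\<forall>i. Ck k (partial i f))"

definition test_functions :: "((real ^ 'n) \<Rightarrow> complex) set" where
  "test_functions = {\<psi>. (\<forall>k. Ck k \<psi>) \<and> compact (closure {x. \<psi> x \<noteq> 0})}"

definition is_weak_partial ::
    "'n \<Rightarrow> ((real ^ 'n) \<Rightarrow> complex) \<Rightarrow> ((real ^ 'n) \<Rightarrow> complex) \<Rightarrow> bool" where
  "is_weak_partial i u g \<longleftrightarrow>
     (\<forall>\<psi>\<in>test_functions. (LINT x|lborel. u x * partial i \<psi> x) = - (LINT x|lborel. g x * \<psi> x))"

definition H1 :: "((real ^ 'n) \<Rightarrow> complex) set" where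
  "H1 = {u \<in> L2. \<forall>i. \<exists>g\<in>L2. is_weak_partial i u g}"

(* For u in H1 the weak derivative is unique up to a null set, so the choice of a
   representative does not affect the form below. *)
definition weak_partial :: "'n \<Rightarrow> ((real ^ 'n) \<Rightarrow> complex) \<Rightarrow> (real ^ 'n) \<Rightarrow> complex" where
  "weak_partial i u = (SOME g. g \<in> L2 \<and> is_weak_partial i u g)"

definition sqrt_mult :: "((real ^ 'n) \<Rightarrow> real) \<Rightarrow> ((real ^ 'n) \<Rightarrow> complex) \<Rightarrow> (real ^ 'n) \<Rightarrow> complex" where
  "sqrt_mult q u x = complex_of_real (sqrt (q x)) * u x"

definition form_domain :: "((real ^ 'n) \<Rightarrow> real) \<Rightarrow> ((real ^ 'n) \<Rightarrow> complex) set" where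
  "form_domain q = {u \<in> H1. sqrt_mult q u \<in> L2}"

definition form ::
    "((real ^ 'n) \<Rightarrow> real) \<Rightarrow> ((real ^ 'n) \<Rightarrow> complex) \<Rightarrow> ((real ^ 'n) \<Rightarrow> complex) \<Rightarrow> complex" where
  "form q u v = (\<Sum>i\<in>UNIV. L2_inner (weak_partial i u) (weak_partial i v))
                + L2_inner (sqrt_mult q u) (sqrt_mult q v)"

(* The operator H = -Laplace + q is given by its graph: schroedinger q u v says that
   u is in D(H) and H u = v. The relation is invariant under changes of u and v on null sets. *)
definition schroedinger ::
    "((real ^ 'n) \<Rightarrow> real) \<Rightarrow> ((real ^ 'n) \<Rightarrow> complex) \<Rightarrow> ((real ^ 'n) \<Rightarrow> complex) \<Rightarrow> bool" where
  "schroedinger q u v \<longleftrightarrow>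
     u \<in> form_domain q \<and> v \<in> L2 \<and> (\<forall>w\<in>form_domain q. form q u w = L2_inner v w)"

(* H - z is injective, surjective and has a bounded inverse; H u = z u + g encodes (H - z) u = g. *)
definition resolvent_set :: "((real ^ 'n) \<Rightarrow> real) \<Rightarrow> complex set" where
  "resolvent_set q = {z.
     (\<forall>u. schroedinger q u (\<lambda>x. z * u x) \<longrightarrow> (AE x in lborel. u x = 0)) \<and>
     (\<forall>g\<in>L2. \<exists>u. schroedinger q u (\<lambda>x. z * u x + g x)) \<and>
     (\<exists>C. \<forall>g\<in>L2. \<forall>u. schroedinger q u (\<lambda>x. z * u x + g x) \<longrightarrow> L2_norm u \<le> C * L2_norm g)}"

definition spectrum :: "((real ^ 'n) \<Rightarrow> real) \<Rightarrow> complex set" where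
  "spectrum q = - resolvent_set q"

definition is_ground_energy :: "((real ^ 'n) \<Rightarrow> real) \<Rightarrow> real \<Rightarrow> bool" where
  "is_ground_energy q E \<longleftrightarrow>
     complex_of_real E \<in> spectrum q \<and> (\<forall>z\<in>spectrum q. z \<in> \<real> \<and> E \<le> Re z)"

definition is_ground_state :: "((real ^ 'n) \<Rightarrow> real) \<Rightarrow> ((real ^ 'n) \<Rightarrow> real) \<Rightarrow> bool" where
  "is_ground_state q \<phi> \<longleftrightarrow>
     continuous_on UNIV \<phi> \<and> (\<forall>x. \<phi> x > 0) \<and> L2_norm (\<lambda>x. complex_of_real (\<phi> x)) = 1 \<and>
     (\<exists>E. is_ground_energy q E \<and>
          schroedinger q (\<lambda>x. complex_of_real (\<phi> x)) (\<lambda>x. complex_of_real E * complex_of_real (\<phi> x)))"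

end

(* The core is the lower bound c exp (-2 J(|x|)) <= phi(x) for large |x|, where J(r) is the integral
   of the square root of Q over [0, r]. The barrier exp (-2 J(|x|)) is a strict subsolution: its
   Laplacian is at least 3 Q(|x|) times itself, because Q' = o(Q^(3/2)) and r < Q(r)^(1/2), while
   Laplace phi = (q - E) phi and q - E <= 2 Q. At a positive maximum of (barrier - phi) this would
   contradict the fact that phi, a continuous distributional solution, is a viscosity supersolution.
   No maximum principle in H^1 is needed. Finally q >= d J f(ln J) with f(ln J) tending to infinity,
   so 2 J <= eps q for large |x|. *)

theory Submission
  imports Defs
begin

subsection \<open>Smooth bump functions\<close>

text \<open>The ground state enters only as a form eigenfunction with a continuous representative:
  no pointwise second derivative of it is available, and \<open>weak_partial\<close> is an arbitrary
  choice among almost everywhere equal functions. All derivatives are therefore moved onto test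
  functions, which have to be constructed and whose weak derivatives have to be identified with the
  classical ones. A second derivative test becomes possible for mollifications of
  \<open>\<phi>\<close>, whose derivatives are integrals of \<open>\<phi>\<close> against translated
  test functions. The factor 2 in exp(-2 J) comes from a budget. The Laplacian of exp(-a J) has
  leading coefficient a^2 Q, while the potential may be as large as Q, so a = 1 leaves no room. With
  a = 2 there is 4 Q: one Q pays for the two lower order terms, one for the potential, one for E,
  and the last makes the comparison strict. Doubling the exponent is harmless, since every constant
  multiple of J is o(q).\<close>

definition flat :: "real poly \<Rightarrow> real \<Rightarrow> real" where
  "flat p t = (if t > 0 then poly p (1 / t) * exp (- (1 / t)) else 0)"

lemma poly_exp_minus_tendsto_0: "((\<lambda>s. poly p s * exp (- s)) \<longlongrightarrow> (0::real)) at_top"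
proof -
  have mono: "((\<lambda>s. s ^ n * exp (- s)) \<longlongrightarrow> (0::real)) at_top" for n
    using tendsto_power_div_exp_0[of n] by (simp add: exp_minus field_simps)
  have "((\<lambda>s. \<Sum>i\<le>degree p. coeff p i * (s ^ i * exp (- s))) \<longlongrightarrow> (\<Sum>i\<le>degree p. coeff p i * 0)) at_top"
    by (intro tendsto_intros mono)
  moreover have "(\<lambda>s. poly p s * exp (- s)) = (\<lambda>s. \<Sum>i\<le>degree p. coeff p i * (s ^ i * exp (- s)))"
    by (simp add: poly_altdef sum_distrib_right mult.assoc)
  ultimately show ?thesis by simp
qed

text \<open>The chain rule with (1/t)' = -1/t^2 turns p(1/t) exp(-1/t) into the same expression with
  X^2 (p - p') in place of p. The family is thus closed under differentiation, and smoothness of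
  exp(-1/t), extended by 0, is an induction over arbitrary p.\<close>

lemma flat_has_derivative:
  "(flat p has_real_derivative flat ([:0, 0, 1:] * (p - pderiv p)) t) (at t)"
proof -
  consider "t > 0" | "t < 0" | "t = 0" by linarith
  then show ?thesis
  proof cases
    case 1
    have "((\<lambda>t. poly p (1 / t) * exp (- (1 / t))) has_real_derivative
            flat ([:0, 0, 1:] * (p - pderiv p)) t) (at t)"
      using 1 by (auto intro!: derivative_eq_intros DERIV_chain2[OF poly_DERIV]
          simp: flat_def field_simps power2_eq_square)
    moreover have "eventually (\<lambda>x. x > 0) (nhds t)"
      using 1 by (rule eventually_nhds_in_open[OF open_greaterThan, of t 0, simplified])
    then have "eventually (\<lambda>x. flat p x = poly p (1 / x) * exp (- (1 / x))) (nhds t)"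
      by eventually_elim (simp add: flat_def)
    ultimately show ?thesis
      by (subst DERIV_cong_ev[OF refl _ refl]) 
  next
    case 2
    have "eventually (\<lambda>x. x < 0) (nhds t)"
      using 2 by (rule eventually_nhds_in_open[OF open_lessThan, of t 0, simplified])
    then have "eventually (\<lambda>x. flat p x = 0) (nhds t)"
      by eventually_elim (simp add: flat_def)
    then show ?thesis
      using 2 by (subst DERIV_cong_ev[OF refl _ refl, where g = "\<lambda>_. 0"]) (auto simp: flat_def)
  next
    case 3
    \<comment> \<open>With s = 1/h the difference quotient at 0 is s p(s) exp(-s), which the
      exponential sends to 0.\<close>
    have r: "((\<lambda>h. flat p h / h) \<longlongrightarrow> 0) (at_right 0)"
    proof -
      have "((\<lambda>h. poly ([:0,1:] * p) (inverse h) * exp (- (inverse h))) \<longlongrightarrow> (0::real)) (at_right 0)"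
        by (rule filterlim_compose[OF poly_exp_minus_tendsto_0 filterlim_inverse_at_top_right])
      moreover have "eventually (\<lambda>h. poly ([:0,1:] * p) (inverse h) * exp (- (inverse h)) = flat p h / h) (at_right 0)"
        by (auto simp: eventually_at_right_field flat_def field_simps intro!: exI[of _ 1])
      ultimately show ?thesis
        by (rule Lim_transform_eventually)
    qed
    have l: "((\<lambda>h. flat p h / h) \<longlongrightarrow> 0) (at_left 0)"
      by (rule tendsto_eventually) (auto simp: eventually_at_left_field flat_def intro!: exI[of _ "-1"])
    show ?thesis
      using filterlim_split_at[OF l r] 3 by (simp add: DERIV_def flat_def)
  qed
qed

text \<open>The derivative is a witness rather than an iterate of \<open>deriv\<close>, so that sums
  and products are handled by exhibiting the derivative; smoothness is differentiability of every
  finite order.\<close>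

primrec diff_times :: "nat \<Rightarrow> (real \<Rightarrow> real) \<Rightarrow> bool" where
  "diff_times 0 f \<longleftrightarrow> True"
| "diff_times (Suc k) f \<longleftrightarrow> (\<exists>f'. (\<forall>t. (f has_real_derivative f' t) (at t)) \<and> diff_times k f')"

definition smooth_real :: "(real \<Rightarrow> real) \<Rightarrow> bool" where
  "smooth_real f \<longleftrightarrow> (\<forall>k. diff_times k f)"

lemma diff_times_Suc_imp: "diff_times (Suc k) f \<Longrightarrow> diff_times k f"
  by (induction k arbitrary: f) (simp, metis diff_times.simps(2))

lemma diff_times_add: "diff_times k f \<Longrightarrow> diff_times k g \<Longrightarrow> diff_times k (\<lambda>t. f t + g t)"
proof (induction k arbitrary: f g)
  case (Suc k)
  then obtain f' g' where
    "\<forall>t. (f has_real_derivative f' t) (at t)" "diff_times k f'"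
    "\<forall>t. (g has_real_derivative g' t) (at t)" "diff_times k g'" by auto
  with Suc.IH[of f' g'] show ?case
    by (auto intro!: exI[of _ "\<lambda>t. f' t + g' t"] derivative_intros)
qed simp

lemma diff_times_mult: "diff_times k f \<Longrightarrow> diff_times k g \<Longrightarrow> diff_times k (\<lambda>t. f t * g t)"
proof (induction k arbitrary: f g)
  case (Suc k)
  then obtain f' g' where *:
    "\<forall>t. (f has_real_derivative f' t) (at t)" "diff_times k f'"
    "\<forall>t. (g has_real_derivative g' t) (at t)" "diff_times k g'" by auto
  have "diff_times k (\<lambda>t. f' t * g t + f t * g' t)"
    using Suc.prems * by (intro diff_times_add Suc.IH) (auto dest: diff_times_Suc_imp simp del: diff_times.simps)
  moreover have "\<forall>t. ((\<lambda>t. f t * g t) has_real_derivative f' t * g t + f t * g' t) (at t)"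
    using * by (auto intro!: derivative_eq_intros)
  ultimately show ?case by auto
qed simp

text \<open>The inner factor c is absorbed into the polynomial, so the induction stays within the
  family \<open>flat p\<close>.\<close>

lemma diff_times_flat_affine: "diff_times k (\<lambda>t. flat p (c * t + d))"
proof (induction k arbitrary: p)
  case (Suc k)
  let ?p' = "smult c ([:0, 0, 1:] * (p - pderiv p))"
  have "((\<lambda>t. flat p (c * t + d)) has_real_derivative flat ?p' (c * t + d)) (at t)" for t
  proof -
    have "((\<lambda>t. flat p (c * t + d)) has_real_derivative
        flat ([:0, 0, 1:] * (p - pderiv p)) (c * t + d) * c) (at t)"
      by (rule DERIV_chain2[OF flat_has_derivative]) (auto intro!: derivative_eq_intros)
    moreover have "flat ([:0, 0, 1:] * (p - pderiv p)) s * c = flat ?p' s" for s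
      by (simp add: flat_def)
    ultimately show ?thesis by metis
  qed
  with Suc.IH[of ?p'] show ?case
    unfolding diff_times.simps by (intro exI[of _ "\<lambda>t. flat ?p' (c * t + d)"]) blast
qed simp

lemma smooth_real_deriv:
  assumes "smooth_real f"
  shows "(f has_real_derivative deriv f t) (at t)" "smooth_real (deriv f)"
proof -
  have 1: "(f has_real_derivative deriv f t) (at t)" for t
    using assms DERIV_imp_deriv[of f _ t] unfolding smooth_real_def
    by (metis diff_times.simps(2))
  then show "(f has_real_derivative deriv f t) (at t)" .
  have "diff_times k (deriv f)" for k
  proof -
    obtain f' where f': "\<forall>t. (f has_real_derivative f' t) (at t)" "diff_times k f'"
      using assms unfolding smooth_real_def by (metis diff_times.simps(2))
    then have "f' = deriv f" by (auto intro!: ext DERIV_imp_deriv[symmetric])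
    with f' show ?thesis by simp
  qed
  then show "smooth_real (deriv f)" by (simp add: smooth_real_def)
qed

text \<open>For c > 0 the function is positive exactly on the open interval from a to b. The
  parameter c is a steepness: since exp(-1/(c s)) tends to 1 for s > 0, the indicator of the
  interval is the limit as c grows.\<close>

definition bump :: "real \<Rightarrow> real \<Rightarrow> real \<Rightarrow> real \<Rightarrow> real" where
  "bump c a b t = flat 1 (c * (t - a)) * flat 1 (c * (b - t))"

lemma smooth_real_bump: "smooth_real (bump c a b)"
proof -
  have "bump c a b = (\<lambda>t. flat 1 (c * t + (- c * a)) * flat 1 ((- c) * t + c * b))"
    by (auto simp: bump_def algebra_simps)
  then show ?thesis
    unfolding smooth_real_def by (metis diff_times_mult diff_times_flat_affine)
qed

lemma bump_nonneg: "bump c a b t \<ge> 0"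
  by (simp add: bump_def flat_def)

lemma bump_le_1: "bump c a b t \<le> 1"
  by (auto simp: bump_def flat_def intro!: mult_le_one)

lemma bump_pos: "c > 0 \<Longrightarrow> a < t \<Longrightarrow> t < b \<Longrightarrow> bump c a b t > 0"
  by (simp add: bump_def flat_def)

lemma bump_eq_0: "c > 0 \<Longrightarrow> t \<notin> {a<..<b} \<Longrightarrow> bump c a b t = 0"
  by (auto simp: bump_def flat_def zero_less_mult_iff)

lemma bump_tendsto_indicator: "(\<lambda>j. bump (real (Suc j)) a b t) \<longlonglongrightarrow> indicator {a<..<b} t"
proof (cases "t \<in> {a<..<b}")
  case True
  have *: "(\<lambda>j. flat 1 (real (Suc j) * s)) \<longlonglongrightarrow> 1" if "s > 0" for s
  proof -
    have "(\<lambda>j. exp (- (1 / s * inverse (real (Suc j))))) \<longlonglongrightarrow> exp (- (1 / s * 0))"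
      by (intro tendsto_intros LIMSEQ_inverse_real_of_nat)
    moreover have "flat 1 (real (Suc j) * s) = exp (- (1 / s * inverse (real (Suc j))))" for j
      using that by (simp add: flat_def divide_simps)
    ultimately show ?thesis by simp
  qed
  have "(\<lambda>j. flat 1 (real (Suc j) * (t - a)) * flat 1 (real (Suc j) * (b - t))) \<longlonglongrightarrow> 1 * 1"
    using True by (intro tendsto_mult *) auto
  then show ?thesis using True by (simp add: bump_def)
next
  case False
  then have "bump (real (Suc j)) a b t = 0" for j by (intro bump_eq_0) auto
  with False show ?thesis by simp
qed

section \<open>Tensor products of one-variable bumps as test functions\<close>

definition tensor :: "('n::finite \<Rightarrow> real \<Rightarrow> real) \<Rightarrow> real ^ 'n \<Rightarrow> complex" where
  "tensor \<beta> x = complex_of_real (\<Prod>i\<in>UNIV. \<beta> i (x $ i))"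

lemma tensor_has_derivative:
  assumes "\<And>i. smooth_real (\<beta> i)"
  shows "(tensor \<beta> has_derivative (\<lambda>h. \<Sum>i\<in>UNIV. (h $ i) *\<^sub>R tensor (\<beta>(i := deriv (\<beta> i))) x)) (at x)"
proof -
  have 1: "((\<lambda>x. \<beta> i (x $ i)) has_derivative (\<lambda>h. (h $ i) * deriv (\<beta> i) (x $ i))) (at x)" for i
  proof -
    have "(\<beta> i has_derivative (\<lambda>h. h * deriv (\<beta> i) (x $ i))) (at (x $ i))"
      using smooth_real_deriv(1)[OF assms, of i "x $ i"]
      by (simp add: has_field_derivative_def mult.commute mult_commute_abs)
    then show ?thesis
      by (rule has_derivative_compose[rotated]) (rule bounded_linear_imp_has_derivative, rule bounded_linear_vec_nth)
  qed
  have 2: "((\<lambda>x. \<Prod>i\<in>UNIV. \<beta> i (x $ i)) has_derivative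
      (\<lambda>h. \<Sum>i\<in>UNIV. (h $ i) * deriv (\<beta> i) (x $ i) * (\<Prod>j\<in>UNIV - {i}. \<beta> j (x $ j)))) (at x)"
    by (rule has_derivative_prod) (rule 1)
  have 3: "tensor (\<beta>(i := deriv (\<beta> i))) x =
      complex_of_real (deriv (\<beta> i) (x $ i) * (\<Prod>j\<in>UNIV - {i}. \<beta> j (x $ j)))" for i
    unfolding tensor_def by (subst prod.remove[of _ i]) (auto intro!: prod.cong)
  have "(tensor \<beta> has_derivative (\<lambda>h. complex_of_real (\<Sum>i\<in>UNIV. (h $ i) * deriv (\<beta> i) (x $ i) * (\<Prod>j\<in>UNIV - {i}. \<beta> j (x $ j))))) (at x)"
    unfolding tensor_def by (rule has_derivative_of_real[OF 2])
  then show ?thesis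
    unfolding 3 by (simp add: scaleR_conv_of_real mult_ac)
qed

text \<open>Differentiating in direction i replaces the i-th factor by its derivative and keeps the
  tensor form; this is what lets \<open>Ck\<close> be proved by induction over all factor
  families.\<close>

lemma partial_tensor:
  assumes "\<And>i. smooth_real (\<beta> i)"
  shows "partial i (tensor \<beta>) = tensor (\<beta>(i := deriv (\<beta> i)))"
proof
  fix x
  have "partial i (tensor \<beta>) x = (\<Sum>j\<in>UNIV. (axis i 1 $ j) *\<^sub>R tensor (\<beta>(j := deriv (\<beta> j))) x)"
    unfolding partial_def
    by (subst frechet_derivative_at[OF tensor_has_derivative, symmetric]) (rule assms, rule refl)
  also have "\<dots> = (\<Sum>j\<in>UNIV. if j = i then tensor (\<beta>(j := deriv (\<beta> j))) x else 0)"
    by (intro sum.cong) (auto simp: axis_def)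
  finally show "partial i (tensor \<beta>) x = tensor (\<beta>(i := deriv (\<beta> i))) x" by simp
qed

lemma Ck_tensor:
  assumes "\<And>i. smooth_real (\<beta> i)"
  shows "Ck k (tensor \<beta>)"
  using assms
proof (induction k arbitrary: \<beta>)
  case 0
  then show ?case
    by (auto simp: continuous_on_eq_continuous_within intro!: has_derivative_continuous[OF tensor_has_derivative])
next
  case (Suc k)
  have "Ck k (tensor (\<beta>(i := deriv (\<beta> i))))" for i
    using Suc.prems by (intro Suc.IH) (auto intro: smooth_real_deriv)
  then show ?case
    using Suc.prems by (auto simp: partial_tensor differentiable_def intro!: tensor_has_derivative exI)
qed

definition box_bump :: "real \<Rightarrow> real ^ 'n::finite \<Rightarrow> real ^ 'n \<Rightarrow> real ^ 'n \<Rightarrow> real" where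
  "box_bump c a b x = (\<Prod>i\<in>UNIV. bump c (a $ i) (b $ i) (x $ i))"

lemma box_bump_nonneg: "box_bump c a b x \<ge> 0"
  by (auto simp: box_bump_def intro!: prod_nonneg bump_nonneg)

lemma box_bump_le_1: "box_bump c a b x \<le> 1"
  by (auto simp: box_bump_def intro!: prod_le_1 bump_nonneg bump_le_1)

lemma box_bump_pos: "c > 0 \<Longrightarrow> x \<in> box a b \<Longrightarrow> box_bump c a b x > 0"
  by (auto simp: box_bump_def mem_box_cart intro!: prod_pos bump_pos)

lemma box_bump_eq_0: "c > 0 \<Longrightarrow> x \<notin> box a b \<Longrightarrow> box_bump c a b x = 0"
  by (force simp: box_bump_def mem_box_cart intro!: prod_zero bump_eq_0)

lemma box_bump_tendsto_indicator:
  "(\<lambda>j. box_bump (real (Suc j)) a b x) \<longlonglongrightarrow> indicator (box a b) x"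
proof -
  have "(\<lambda>j. box_bump (real (Suc j)) a b x) \<longlonglongrightarrow> (\<Prod>i\<in>UNIV. indicator {a $ i<..<b $ i} (x $ i))"
    unfolding box_bump_def by (intro tendsto_prod bump_tendsto_indicator)
  moreover have "(\<Prod>i\<in>UNIV. indicator {a $ i<..<b $ i} (x $ i)) = (indicator (box a b) x :: real)"
  proof (cases "x \<in> box a b")
    case False
    then obtain i where "\<not> (a $ i < x $ i \<and> x $ i < b $ i)" by (auto simp: mem_box_cart)
    then have "(\<Prod>i\<in>UNIV. indicator {a $ i<..<b $ i} (x $ i)) = (0 :: real)"
      by (intro prod_zero) (auto intro!: exI[of _ i])
    with False show ?thesis by simp
  qed (auto simp: mem_box_cart intro!: prod.neutral)
  ultimately show ?thesis by simp
qed

lemma box_bump_test_function: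
  assumes "c > 0"
  shows "(\<lambda>x. complex_of_real (box_bump c a b x)) \<in> test_functions"
proof -
  have "(\<lambda>x. complex_of_real (box_bump c a b x)) = tensor (\<lambda>i. bump c (a $ i) (b $ i))"
    by (simp add: tensor_def box_bump_def fun_eq_iff)
  moreover have "Ck k (tensor (\<lambda>i. bump c (a $ i) (b $ i)))" for k
    by (intro Ck_tensor smooth_real_bump)
  moreover have "bounded {x. tensor (\<lambda>i. bump c (a $ i) (b $ i)) x \<noteq> 0}"
    unfolding calculation(1)[symmetric] by (rule bounded_subset[OF bounded_box[of a b]]) (use assms box_bump_eq_0 in force)
  ultimately show ?thesis
    unfolding test_functions_def by auto
qed

subsection \<open>Test functions and integration by parts\<close>

text \<open>The quotient form allows a derivative of an integral to be computed along sequences by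
  dominated convergence.\<close>

lemma has_vector_derivative_at_iff_quotient:
  fixes F :: "real \<Rightarrow> 'a::real_normed_vector"
  shows "(F has_vector_derivative D) (at s) \<longleftrightarrow> ((\<lambda>h. (F (s + h) - F s) /\<^sub>R h) \<longlongrightarrow> D) (at 0)"
proof -
  have "(F has_vector_derivative D) (at s) \<longleftrightarrow>
      ((\<lambda>h. norm (F (s + h) - F s - h *\<^sub>R D) / norm h) \<longlongrightarrow> 0) (at 0)"
    by (simp add: has_vector_derivative_def has_derivative_at bounded_linear_scaleR_left)
  also have "\<dots> \<longleftrightarrow> ((\<lambda>h. norm ((F (s + h) - F s) /\<^sub>R h - D)) \<longlongrightarrow> 0) (at 0)"
  proof (rule tendsto_cong)
    have "norm (F (s + h) - F s - h *\<^sub>R D) / norm h = norm ((F (s + h) - F s) /\<^sub>R h - D)" if "h \<noteq> 0" for h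
    proof -
      have "(F (s + h) - F s) /\<^sub>R h - D = (F (s + h) - F s - h *\<^sub>R D) /\<^sub>R h"
        using that by (simp add: algebra_simps)
      then show ?thesis by (simp add: divide_inverse_commute)
    qed
    then show "\<forall>\<^sub>F h in at 0. norm (F (s + h) - F s - h *\<^sub>R D) / norm h = norm ((F (s + h) - F s) /\<^sub>R h - D)"
      by (auto simp: eventually_at intro: exI[of _ 1])
  qed
  also have "\<dots> \<longleftrightarrow> ((\<lambda>h. (F (s + h) - F s) /\<^sub>R h) \<longlongrightarrow> D) (at 0)"
    by (simp add: tendsto_norm_zero_iff LIM_zero_iff)
  finally show ?thesis .
qed

text \<open>A common frame for weak derivatives, which lie in L^2, and for continuous functions,
  neither of which need be integrable over the whole space.\<close>

definition locally_integrable :: "(real ^ 'n \<Rightarrow> complex) \<Rightarrow> bool" where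
  "locally_integrable u \<longleftrightarrow> (\<forall>K. compact K \<longrightarrow> set_integrable lborel K u)"

lemma locally_integrable_continuous:
  "continuous_on UNIV u \<Longrightarrow> locally_integrable u"
  unfolding locally_integrable_def
  by (auto intro!: borel_integrable_compact continuous_on_subset[of UNIV u] simp: set_integrable_def)

text \<open>On a compact set, which has finite measure, |u| is dominated by 1 + |u|^2.\<close>

lemma locally_integrable_L2:
  fixes u :: "real ^ 'n \<Rightarrow> complex"
  assumes "u \<in> L2"
  shows "locally_integrable u"
  unfolding locally_integrable_def set_integrable_def
proof safe
  fix K :: "(real ^ 'n) set" assume K: "compact K"
  then have [measurable]: "K \<in> sets borel" by (simp add: borel_compact)
  have [measurable]: "u \<in> borel_measurable borel" and u: "integrable lborel (\<lambda>x. (norm (u x))\<^sup>2)"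
    using assms by (auto simp: L2_def)
  have "integrable lborel (\<lambda>x. indicator K x *\<^sub>R (1::real))"
    using K by (intro borel_integrable_compact) auto
  then have 1: "integrable lborel (\<lambda>x. indicator K x + (norm (u x))\<^sup>2)"
    using u by simp
  have *: "s \<le> 1 + s\<^sup>2" for s :: real
    using zero_le_power2[of "s - 1"] by (simp add: power2_eq_square algebra_simps) (smt (verit) zero_le_square)
  show "integrable lborel (\<lambda>x. indicator K x *\<^sub>R u x)"
    by (rule Bochner_Integration.integrable_bound[OF 1]) (use * in \<open>auto simp: indicator_def\<close>)
qed

lemma locally_integrable_mult:
  fixes u :: "real ^ 'n \<Rightarrow> complex" and f :: "real ^ 'n \<Rightarrow> complex"
  assumes u: "locally_integrable u" and K: "compact K" and [measurable]: "f \<in> borel_measurable borel"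
    and B: "\<And>x. norm (f x) \<le> B" and 0: "\<And>x. x \<notin> K \<Longrightarrow> f x = 0"
  shows "integrable lborel (\<lambda>x. u x * f x)"
proof -
  have i: "integrable lborel (\<lambda>x. indicator K x *\<^sub>R u x)"
    using u K by (auto simp: locally_integrable_def set_integrable_def)
  have [measurable]: "(\<lambda>x. indicator K x *\<^sub>R u x) \<in> borel_measurable borel"
    using borel_measurable_integrable[OF i] by simp
  have eq: "u x * f x = (indicator K x *\<^sub>R u x) * f x" for x
    using 0[of x] by (auto simp: indicator_def)
  have "norm (u x * f x) \<le> norm (B *\<^sub>R (indicator K x *\<^sub>R u x))" for x
    unfolding eq norm_mult norm_scaleR using B[of x] norm_ge_zero[of "f x"]
    by (auto simp: indicator_def mult.commute[of _ "norm (f x)"] intro!: mult_right_mono)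
  moreover have "integrable lborel (\<lambda>x. B *\<^sub>R (indicator K x *\<^sub>R u x))"
    using i by (rule integrable_scaleR_right)
  ultimately show ?thesis
    by (rule Bochner_Integration.integrable_bound[rotated 2, OF always_eventually[OF allI]])
      (subst eq, measurable)
qed

lemma test_functionsD:
  assumes "f \<in> test_functions"
  shows "continuous_on UNIV f" "compact (closure {x. f x \<noteq> 0})" "\<And>x. x \<notin> closure {x. f x \<noteq> 0} \<Longrightarrow> f x = 0"
    "f differentiable (at x)"
proof -
  have "Ck 0 f" "Ck (Suc 0) f" using assms unfolding test_functions_def by blast+
  then show "continuous_on UNIV f" "f differentiable (at x)" by auto
  show "compact (closure {x. f x \<noteq> 0})" using assms unfolding test_functions_def by blast
  show "f x = 0" if "x \<notin> closure {x. f x \<noteq> 0}" for x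
    using that closure_subset[of "{x. f x \<noteq> 0}"] by blast
qed

lemma test_functions_bounded:
  assumes "f \<in> test_functions"
  obtains B where "\<And>x. norm (f x) \<le> B"
proof -
  let ?K = "closure {x. f x \<noteq> 0}"
  have "compact (f ` ?K)"
    by (intro compact_continuous_image continuous_on_subset[OF test_functionsD(1)] test_functionsD(2) assms subset_UNIV)
  then obtain B where B: "\<And>x. x \<in> ?K \<Longrightarrow> norm (f x) \<le> B"
    by (meson bounded_iff compact_imp_bounded imageI)
  have "norm (f x) \<le> max B 0" for x
    using B[of x] test_functionsD(3)[OF assms, of x] by (cases "x \<in> ?K") auto
  then show ?thesis by (rule that)
qed

lemma partial_eq_0_off_support:
  assumes "x \<notin> closure {x. f x \<noteq> 0}"
  shows "partial i f x = 0"
proof -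
  have "(f has_derivative (\<lambda>_. 0)) (at x)"
    by (rule has_derivative_transform_within_open[of "\<lambda>_. 0" _ _ UNIV "- closure {x. f x \<noteq> 0}"])
      (use assms closure_subset[of "{x. f x \<noteq> 0}"] in auto)
  then show ?thesis by (simp add: partial_def frechet_derivative_at[symmetric])
qed

lemma partial_test_functions:
  assumes "f \<in> test_functions"
  shows "partial i f \<in> test_functions"
proof -
  have "Ck k (partial i f)" for k
  proof -
    have "Ck (Suc k) f" using assms unfolding test_functions_def by blast
    then show ?thesis by simp
  qed
  moreover have "{x. partial i f x \<noteq> 0} \<subseteq> closure {x. f x \<noteq> 0}"
    using partial_eq_0_off_support by blast
  then have "closure {x. partial i f x \<noteq> 0} \<subseteq> closure {x. f x \<noteq> 0}"
    by (simp add: closure_minimal)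
  then have "compact (closure {x. partial i f x \<noteq> 0})"
    using test_functionsD(2)[OF assms] by (metis closed_closure compact_Int_closed inf.absorb_iff2)
  ultimately show ?thesis by (simp add: test_functions_def)
qed

lemma test_function_line_derivative:
  assumes "f \<in> test_functions"
  shows "((\<lambda>s. f (y + s *\<^sub>R axis i 1)) has_vector_derivative partial i f (y + s *\<^sub>R axis i 1)) (at s)"
proof -
  have f: "(f has_derivative frechet_derivative f (at (y + s *\<^sub>R axis i 1))) (at (y + s *\<^sub>R axis i 1))"
    using test_functionsD(4)[OF assms] frechet_derivative_works by blast
  interpret bounded_linear "frechet_derivative f (at (y + s *\<^sub>R axis i 1))"
    using f by (rule has_derivative_bounded_linear)
  have "((\<lambda>s. y + s *\<^sub>R axis i 1) has_derivative (\<lambda>h. h *\<^sub>R axis i 1)) (at s)"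
    by (auto intro!: derivative_eq_intros)
  from diff_chain_at[OF this f] show ?thesis
    by (simp add: has_vector_derivative_def o_def scale partial_def)
qed

text \<open>Bounds the difference quotients uniformly, as a dominating function for differentiation
  under the integral.\<close>

lemma test_function_line_lipschitz:
  assumes f: "f \<in> test_functions" and B: "\<And>x. norm (partial i f x) \<le> B"
  shows "norm (f (y + h *\<^sub>R axis i 1) - f y) \<le> B * \<bar>h\<bar>"
proof -
  have "norm ((\<lambda>s. f (y + s *\<^sub>R axis i 1)) h - (\<lambda>s. f (y + s *\<^sub>R axis i 1)) 0) \<le> B * norm (h - 0)"
  proof (rule differentiable_bound[OF convex_UNIV])
    show "((\<lambda>s. f (y + s *\<^sub>R axis i 1)) has_derivative (\<lambda>h. h *\<^sub>R partial i f (y + s *\<^sub>R axis i 1))) (at s within UNIV)" for s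
      using test_function_line_derivative[OF f] by (simp add: has_vector_derivative_def)
    show "onorm (\<lambda>h. h *\<^sub>R partial i f (y + s *\<^sub>R axis i 1)) \<le> B" for s
      using B by (simp add: onorm_scaleR_left bounded_linear_ident onorm_id)
  qed auto
  then show ?thesis by simp
qed

lemma borel_measurable_test_function: "f \<in> test_functions \<Longrightarrow> f \<in> borel_measurable borel"
  by (intro borel_measurable_continuous_onI test_functionsD)

lemma integrable_mult_test_function:
  assumes "locally_integrable u" "f \<in> test_functions"
  shows "integrable lborel (\<lambda>x. u x * f x)"
proof -
  obtain B where "\<And>x. norm (f x) \<le> B" using test_functions_bounded[OF assms(2)] by blast
  then show ?thesis
    using assms by (intro locally_integrable_mult[of u "closure {x. f x \<noteq> 0}"]
        test_functionsD borel_measurable_test_function) auto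
qed

lemma integrable_mult_test_function_shift:
  fixes u :: "real ^ 'n \<Rightarrow> complex"
  assumes u: "locally_integrable u" and f: "f \<in> test_functions"
  shows "integrable lborel (\<lambda>x. u x * f (x + z))"
proof -
  obtain B where B: "\<And>x. norm (f x) \<le> B" using test_functions_bounded[OF f] by blast
  note [measurable] = borel_measurable_test_function[OF f]
  let ?K = "(\<lambda>y. y - z) ` closure {x. f x \<noteq> 0}"
  have "compact ?K"
    using test_functionsD(2)[OF f] by (intro compact_continuous_image) (auto intro!: continuous_intros)
  moreover have "f (x + z) = 0" if "x \<notin> ?K" for x
    using that test_functionsD(3)[OF f, of "x + z"] by (force simp: image_iff)
  ultimately show ?thesis
    by (intro locally_integrable_mult[OF u, of ?K _ B]) (use B in auto)
qed

lemma has_vector_derivative_integral_test_function: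
  fixes u :: "real ^ 'n \<Rightarrow> complex"
  assumes u: "locally_integrable u" and f: "f \<in> test_functions"
  shows "((\<lambda>t. LINT y|lborel. u y * f (y + z + t *\<^sub>R axis i 1)) has_vector_derivative
          (LINT y|lborel. u y * partial i f (y + z + s *\<^sub>R axis i 1))) (at s)"
  unfolding has_vector_derivative_at_iff_quotient tendsto_at_iff_sequentially
proof (intro allI impI, unfold o_def)
  fix X :: "nat \<Rightarrow> real"
  assume X: "\<forall>n. X n \<in> UNIV - {0}" "X \<longlonglongrightarrow> 0"
  let ?e = "axis i 1 :: real ^ 'n" and ?z = "z + s *\<^sub>R axis i 1 :: real ^ 'n"
  note p = partial_test_functions[OF f, of i]
  note [measurable] = borel_measurable_test_function[OF f] borel_measurable_test_function[OF p]
  obtain B where B: "\<And>x. norm (partial i f x) \<le> B" using test_functions_bounded[OF p] by blast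
  obtain M where M: "M > 0" "\<And>n. \<bar>X n\<bar> \<le> M"
    using convergent_imp_Bseq[OF convergentI[OF X(2)]] by (auto simp: Bseq_def)
  let ?S = "closure {x. f x \<noteq> 0}"
  \<comment> \<open>K collects every y that some shift with |t| at most M moves into the support. It
    is compact, and all difference quotients along X vanish off it, so B |u| restricted to K
    dominates.\<close>
  define K where "K = (\<lambda>(y, t). y - ?z - t *\<^sub>R ?e) ` (?S \<times> {-M..M})"
  have K: "compact K"
    unfolding K_def split_def
    by (intro compact_continuous_image compact_Times test_functionsD f) (auto intro!: continuous_intros)
  have 0: "f (y + ?z + t *\<^sub>R ?e) = 0" if "y \<notin> K" "\<bar>t\<bar> \<le> M" for y t
  proof (rule test_functionsD(3)[OF f], rule)
    assume "y + ?z + t *\<^sub>R ?e \<in> ?S"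
    then have "y \<in> K" unfolding K_def using that(2)
      by (intro image_eqI[of _ _ "(y + ?z + t *\<^sub>R ?e, t)"]) auto
    with that show False by simp
  qed
  have q: "norm ((f (y + ?z + X n *\<^sub>R ?e) - f (y + ?z)) /\<^sub>R X n) \<le> B * indicator K y" for y n
  proof (cases "y \<in> K")
    case True
    have "norm (f (y + ?z + X n *\<^sub>R ?e) - f (y + ?z)) \<le> B * \<bar>X n\<bar>"
      by (rule test_function_line_lipschitz[OF f B])
    then have "norm (f (y + ?z + X n *\<^sub>R ?e) - f (y + ?z)) / \<bar>X n\<bar> \<le> B"
      using X(1) by (simp add: pos_divide_le_eq)
    then show ?thesis using True by (simp add: divide_inverse_commute)
  next
    case False
    then show ?thesis using 0[OF False M(2)] 0[OF False, of 0] M(1) by simp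
  qed
  have "(\<lambda>n. LINT y|lborel. u y * ((f (y + ?z + X n *\<^sub>R ?e) - f (y + ?z)) /\<^sub>R X n))
      \<longlonglongrightarrow> (LINT y|lborel. u y * partial i f (y + ?z))"
  proof (rule integral_dominated_convergence)
    show meas: "(\<lambda>y. u y * partial i f (y + ?z)) \<in> borel_measurable lborel"
      by (rule borel_measurable_integrable[OF integrable_mult_test_function_shift[OF u p]])
    show "(\<lambda>y. u y * ((f (y + ?z + X n *\<^sub>R ?e) - f (y + ?z)) /\<^sub>R X n)) \<in> borel_measurable lborel" for n
    proof -
      have "integrable lborel (\<lambda>y. (u y * f (y + (?z + X n *\<^sub>R ?e)) - u y * f (y + ?z)) /\<^sub>R X n)"
        by (intro integrable_scaleR_right Bochner_Integration.integrable_diff integrable_mult_test_function_shift u f)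
      from borel_measurable_integrable[OF this] show ?thesis
        by (simp add: algebra_simps)
    qed
    show "AE y in lborel. (\<lambda>n. u y * ((f (y + ?z + X n *\<^sub>R ?e) - f (y + ?z)) /\<^sub>R X n)) \<longlonglongrightarrow> u y * partial i f (y + ?z)"
    proof (intro AE_I2 tendsto_mult tendsto_const)
      fix y
      have "((\<lambda>h. (f (y + ?z + (0 + h) *\<^sub>R ?e) - f (y + ?z + 0 *\<^sub>R ?e)) /\<^sub>R h) \<longlongrightarrow> partial i f (y + ?z + 0 *\<^sub>R ?e)) (at 0)"
        using test_function_line_derivative[OF f, of "y + ?z" i 0] unfolding has_vector_derivative_at_iff_quotient .
      then show "(\<lambda>n. (f (y + ?z + X n *\<^sub>R ?e) - f (y + ?z)) /\<^sub>R X n) \<longlonglongrightarrow> partial i f (y + ?z)"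
        unfolding tendsto_at_iff_sequentially o_def using X by simp
    qed
    have i: "integrable lborel (\<lambda>y. indicator K y *\<^sub>R u y)"
      using u K by (auto simp: locally_integrable_def set_integrable_def)
    show "integrable lborel (\<lambda>y. B * norm (indicator K y *\<^sub>R u y))"
      using i by (intro integrable_mult_right integrable_norm)
    show "AE y in lborel. norm (u y * ((f (y + ?z + X n *\<^sub>R ?e) - f (y + ?z)) /\<^sub>R X n)) \<le> B * norm (indicator K y *\<^sub>R u y)" for n
    proof (intro AE_I2)
      fix y
      have "norm (u y * ((f (y + ?z + X n *\<^sub>R ?e) - f (y + ?z)) /\<^sub>R X n)) \<le> norm (u y) * (B * indicator K y)"
        unfolding norm_mult by (rule mult_left_mono[OF q]) auto
      then show "norm (u y * ((f (y + ?z + X n *\<^sub>R ?e) - f (y + ?z)) /\<^sub>R X n)) \<le> B * norm (indicator K y *\<^sub>R u y)"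
        by (simp add: mult_ac)
    qed
  qed
  moreover have "(LINT y|lborel. u y * ((f (y + ?z + X n *\<^sub>R ?e) - f (y + ?z)) /\<^sub>R X n)) =
      ((LINT y|lborel. u y * f (y + z + (s + X n) *\<^sub>R ?e)) - (LINT y|lborel. u y * f (y + z + s *\<^sub>R ?e))) /\<^sub>R X n" for n
  proof -
    have i: "integrable lborel (\<lambda>y. u y * f (y + z + r *\<^sub>R ?e))" for r
      using integrable_mult_test_function_shift[OF u f, of "z + r *\<^sub>R ?e"] by (simp add: add.assoc)
    show ?thesis
      by (subst Bochner_Integration.integral_diff[OF i i, symmetric], subst integral_scaleR_right[symmetric])
        (simp add: algebra_simps)
  qed
  ultimately show "(\<lambda>n. ((LINT y|lborel. u y * f (y + z + (s + X n) *\<^sub>R ?e)) - (LINT y|lborel. u y * f (y + z + s *\<^sub>R ?e))) /\<^sub>R X n)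
      \<longlonglongrightarrow> (LINT y|lborel. u y * partial i f (y + z + s *\<^sub>R ?e))"
    by (simp only: add.assoc)
qed

lemma lborel_integral_shift:
  fixes f :: "'a::euclidean_space \<Rightarrow> 'b::{banach, second_countable_topology}"
  assumes [measurable]: "f \<in> borel_measurable borel"
  shows "(LINT x|lborel. f (c + x)) = (LINT x|lborel. f x)"
  by (subst (2) lborel_distr_plus[of c, symmetric], subst integral_distr) auto

text \<open>Integration by parts from translation invariance alone: the integrals of \<psi>(y)
  \<eta>(y + t e) and of \<eta>(y) \<psi>(y - t e) agree for every t, and comparing their
  derivatives at t = 0 gives the identity with its minus sign. Neither Fubini nor boundary terms
  occur.\<close>

lemma test_function_is_weak_partial:
  fixes \<psi> :: "real ^ 'n \<Rightarrow> complex"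
  assumes \<psi>: "\<psi> \<in> test_functions"
  shows "is_weak_partial i \<psi> (partial i \<psi>)"
  unfolding is_weak_partial_def
proof
  fix \<eta> :: "real ^ 'n \<Rightarrow> complex" assume \<eta>: "\<eta> \<in> test_functions"
  note [measurable] = borel_measurable_test_function[OF \<psi>] borel_measurable_test_function[OF \<eta>]
  let ?e = "axis i 1 :: real ^ 'n"
  have lp: "locally_integrable \<psi>" "locally_integrable \<eta>"
    by (auto intro!: locally_integrable_continuous test_functionsD \<psi> \<eta>)
  have 1: "((\<lambda>t. LINT y|lborel. \<psi> y * \<eta> (y + t *\<^sub>R ?e)) has_vector_derivative
          (LINT y|lborel. \<psi> y * partial i \<eta> y)) (at 0)"
    using has_vector_derivative_integral_test_function[OF lp(1) \<eta>, of 0 i 0] by simp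
  have 2: "((\<lambda>t. LINT y|lborel. \<eta> y * \<psi> (y + t *\<^sub>R ?e)) has_vector_derivative
          (LINT y|lborel. \<eta> y * partial i \<psi> y)) (at (- 0))"
    using has_vector_derivative_integral_test_function[OF lp(2) \<psi>, of 0 i 0] by simp
  have "((\<lambda>t. LINT y|lborel. \<eta> y * \<psi> (y + (- t) *\<^sub>R ?e)) has_vector_derivative
          - (LINT y|lborel. \<eta> y * partial i \<psi> y)) (at 0)"
    using vector_diff_chain_at[of "\<lambda>t. - t" "-1" 0, OF _ 2]
    by (auto simp: o_def has_vector_derivative_minus intro!: derivative_eq_intros)
  moreover have "(LINT y|lborel. \<eta> y * \<psi> (y + (- t) *\<^sub>R ?e)) = (LINT y|lborel. \<psi> y * \<eta> (y + t *\<^sub>R ?e))" for t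
    by (subst lborel_integral_shift[of _ "t *\<^sub>R ?e", symmetric]) (auto simp: add_ac mult_ac)
  ultimately show "(LINT x|lborel. \<psi> x * partial i \<eta> x) = - (LINT x|lborel. partial i \<psi> x * \<eta> x)"
    using vector_derivative_unique_at[OF 1] by (simp add: mult.commute)
qed

subsection \<open>Weak derivatives and the distributional equation\<close>

text \<open>Box bumps of growing steepness are test functions converging to the indicator of the
  box, dominated by the indicator of the closed box.\<close>

lemma box_integral_eq_0:
  fixes f :: "real ^ 'n \<Rightarrow> complex"
  assumes f: "locally_integrable f" and 0: "\<And>\<psi>. \<psi> \<in> test_functions \<Longrightarrow> (LINT x|lborel. f x * \<psi> x) = 0"
  shows "(LINT x|lborel. indicator (box a b) x *\<^sub>R f x) = 0"
proof -
  let ?\<psi> = "\<lambda>j x. complex_of_real (box_bump (real (Suc j)) a b x)"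
  have c: "set_integrable lborel (cbox a b) f"
    using f by (auto simp: locally_integrable_def)
  then have i: "integrable lborel (\<lambda>y. indicator (cbox a b) y *\<^sub>R f y)"
    by (simp only: set_integrable_def)
  have "set_integrable lborel (box a b) f"
    by (rule set_integrable_subset[OF c]) (auto intro: subsetD[OF box_subset_cbox])
  then have ib: "integrable lborel (\<lambda>y. indicator (box a b) y *\<^sub>R f y)"
    by (simp only: set_integrable_def)
  have t: "?\<psi> j \<in> test_functions" for j by (rule box_bump_test_function) simp
  have "(\<lambda>j. LINT x|lborel. f x * ?\<psi> j x) \<longlonglongrightarrow> (LINT x|lborel. f x * complex_of_real (indicator (box a b) x))"
  proof (rule integral_dominated_convergence)
    show "(\<lambda>x. f x * complex_of_real (indicator (box a b) x)) \<in> borel_measurable lborel"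
      using borel_measurable_integrable[OF ib] by (simp add: scaleR_conv_of_real mult.commute)
    show "(\<lambda>x. f x * ?\<psi> j x) \<in> borel_measurable lborel" for j
      by (rule borel_measurable_integrable[OF integrable_mult_test_function[OF f t]])
    show "integrable lborel (\<lambda>x. norm (indicator (cbox a b) x *\<^sub>R f x))"
      using i by (rule integrable_norm)
    show "AE x in lborel. (\<lambda>j. f x * ?\<psi> j x) \<longlonglongrightarrow> f x * complex_of_real (indicator (box a b) x)"
      by (intro AE_I2 tendsto_mult tendsto_const tendsto_of_real box_bump_tendsto_indicator)
    show "AE x in lborel. norm (f x * ?\<psi> j x) \<le> norm (indicator (cbox a b) x *\<^sub>R f x)" for j
    proof (intro AE_I2)
      fix x
      show "norm (f x * ?\<psi> j x) \<le> norm (indicator (cbox a b) x *\<^sub>R f x)"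
      proof (cases "x \<in> box a b")
        case True
        then have "x \<in> cbox a b" using box_subset_cbox by blast
        then show ?thesis
          using box_bump_nonneg[of "real (Suc j)" a b x] box_bump_le_1[of "real (Suc j)" a b x]
          by (auto simp: norm_mult intro: mult_left_le)
      qed (simp add: box_bump_eq_0)
    qed
  qed
  then have "(LINT x|lborel. f x * complex_of_real (indicator (box a b) x)) = 0"
    unfolding 0[OF t] by (simp add: LIMSEQ_const_iff)
  then show ?thesis by (simp add: scaleR_conv_of_real mult.commute)
qed

text \<open>Boxes form an intersection-stable generator of the Borel sets. Cutting f off to a box
  \<open>B n\<close> makes it integrable, and the cut-off function still integrates to 0 over every
  box, because an intersection of boxes is a box. A Dynkin system argument extends this to all Borel
  sets, and the boxes \<open>B n\<close> exhaust the space.\<close>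

lemma fundamental_lemma_calculus_of_variations:
  fixes f :: "real ^ 'n \<Rightarrow> complex"
  assumes f: "locally_integrable f" and 0: "\<And>\<psi>. \<psi> \<in> test_functions \<Longrightarrow> (LINT x|lborel. f x * \<psi> x) = 0"
  shows "AE x in lborel. f x = 0"
proof -
  define B :: "nat \<Rightarrow> (real ^ 'n) set" where "B n = box (- (real n *\<^sub>R One)) (real n *\<^sub>R One)" for n
  have B0: "AE x in lborel. indicator (B n) x *\<^sub>R f x = 0" for n
  proof (rule sigma_finite_measure.density_zero[OF sigma_finite_lborel])
    have "set_integrable lborel (cbox (- (real n *\<^sub>R One)) (real n *\<^sub>R One)) f"
      using f by (auto simp: locally_integrable_def)
    then have "set_integrable lborel (B n) f"
      by (rule set_integrable_subset) (auto simp: B_def intro: subsetD[OF box_subset_cbox])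
    then show g: "integrable lborel (\<lambda>x. indicator (B n) x *\<^sub>R f x)"
      by (simp add: set_integrable_def)
    let ?g = "\<lambda>x. indicator (B n) x *\<^sub>R f x"
    have gi: "set_integrable lborel A ?g" if "A \<in> sets borel" for A
      unfolding set_integrable_def by (rule integrable_mult_indicator[OF _ g]) (use that in simp)
    fix A :: "(real ^ 'n) set" assume "A \<in> sets lborel"
    then have A: "A \<in> sigma_sets UNIV (range (\<lambda>(a, b). box a b))"
      by (simp add: borel_eq_box)
    have "Int_stable (range (\<lambda>(a, b). box a b :: (real ^ 'n) set))"
      by (auto simp: Int_stable_def box_Int_box)
    moreover have "range (\<lambda>(a, b). box a b) \<subseteq> Pow (UNIV :: (real ^ 'n) set)" by simp
    ultimately show "set_lebesgue_integral lborel A ?g = 0"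
      using A
    proof (induction rule: sigma_sets_induct_disjoint)
      case (basic A)
      then obtain a b where A: "A = box a b" by auto
      obtain a' b' where "box a b \<inter> B n = box a' b'"
        unfolding B_def box_Int_box by blast
      then have "indicator A x *\<^sub>R ?g x = indicator (box a' b') x *\<^sub>R f x" for x
        unfolding A by (metis indicator_inter_arith scaleR_scaleR)
      then show ?case
        using box_integral_eq_0[OF f 0, of a' b'] by (simp only: set_lebesgue_integral_def)
    next
      case empty
      then show ?case by (simp add: set_lebesgue_integral_def)
    next
      case (compl A)
      then have A: "A \<in> sets borel" by (simp add: borel_eq_box)
      \<comment> \<open>Complements need the integral over the whole space; it vanishes because the
        cut-off set is itself a box.\<close>
      have "(LINT x|lborel. ?g x) = 0"
        unfolding B_def by (rule box_integral_eq_0[OF f 0])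
      moreover have "(LINT x:A \<union> (UNIV - A)|lborel. ?g x) = (LINT x:A|lborel. ?g x) + (LINT x:UNIV - A|lborel. ?g x)"
        using A by (intro set_integral_Un gi) auto
      ultimately show ?case using compl by (simp add: set_lebesgue_integral_def)
    next
      case (union A)
      then have A: "range A \<subseteq> sets borel" by (auto simp: borel_eq_box)
      have "(LINT x:(\<Union>i. A i)|lborel. ?g x) = (\<Sum>i. LINT x:A i|lborel. ?g x)"
        using A union(1) by (intro lebesgue_integral_countable_add gi) (auto simp: disjoint_family_on_def)
      then show ?case using union by simp
    qed
  qed
  have "AE x in lborel. \<forall>n. indicator (B n) x *\<^sub>R f x = 0"
    by (rule AE_all_countable[THEN iffD2], rule allI, rule B0)
  then show ?thesis
  proof eventually_elim
    case (elim x)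
    have "(\<Union>n. B n) = UNIV" unfolding B_def by (rule UN_box_eq_UNIV)
    then have "x \<in> (\<Union>n. B n)" by (simp only: UNIV_I)
    then obtain n where "x \<in> B n" by (rule UN_E)
    with elim[rule_format, of n] show ?case by simp
  qed
qed

section \<open>Test functions in the form domain and their weak derivatives\<close>

lemma test_functions_L2:
  assumes "f \<in> test_functions"
  shows "f \<in> L2"
proof -
  have "(\<lambda>x. cnj (f x)) \<in> borel_measurable borel"
    using test_functionsD(1)[OF assms] by (intro borel_measurable_continuous_onI continuous_intros)
  have "locally_integrable (\<lambda>x. cnj (f x))"
    using test_functionsD(1)[OF assms] by (intro locally_integrable_continuous continuous_intros)
  from integrable_norm[OF integrable_mult_test_function[OF this assms]]
  have "integrable lborel (\<lambda>x. (norm (f x))\<^sup>2)"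
    by (simp add: norm_mult power2_eq_square)
  then show ?thesis using borel_measurable_test_function[OF assms] by (simp add: L2_def)
qed

lemma test_functions_form_domain:
  fixes q :: "real ^ 'n \<Rightarrow> real"
  assumes \<psi>: "\<psi> \<in> test_functions" and q: "continuous_on UNIV q" "\<And>x. q x \<ge> 0"
  shows "\<psi> \<in> form_domain q"
proof -
  have "\<psi> \<in> H1"
    unfolding H1_def using \<psi> by (blast intro: test_functions_L2 partial_test_functions test_function_is_weak_partial)
  moreover have "sqrt_mult q \<psi> \<in> L2"
  proof -
    have "continuous_on UNIV (sqrt_mult q \<psi>)"
      unfolding sqrt_mult_def using test_functionsD(1)[OF \<psi>] q by (intro continuous_intros) auto
    then have sm: "sqrt_mult q \<psi> \<in> borel_measurable borel" by (rule borel_measurable_continuous_onI)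
    \<comment> \<open>q |\<psi>|^2 is read as the modulus of the continuous function q cnj \<psi>
      times the test function \<psi>, which gives its integrability.\<close>
    have "locally_integrable (\<lambda>x. complex_of_real (q x) * cnj (\<psi> x))"
      using test_functionsD(1)[OF \<psi>] q by (intro locally_integrable_continuous continuous_intros) auto
    from integrable_norm[OF integrable_mult_test_function[OF this \<psi>]]
    moreover have "(norm (sqrt_mult q \<psi> x))\<^sup>2 = norm (complex_of_real (q x) * cnj (\<psi> x) * \<psi> x)" for x
    proof -
      have "(norm (sqrt_mult q \<psi> x))\<^sup>2 = q x * (norm (\<psi> x))\<^sup>2"
        using q(2)[of x] by (simp add: sqrt_mult_def norm_mult power_mult_distrib)
      also have "\<dots> = norm (complex_of_real (q x) * cnj (\<psi> x) * \<psi> x)"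
        using q(2)[of x] by (simp add: norm_mult) (simp add: power2_eq_square)
      finally show ?thesis .
    qed
    ultimately have "integrable lborel (\<lambda>x. (norm (sqrt_mult q \<psi> x))\<^sup>2)"
      by (simp only:)
    with sm show ?thesis by (simp add: L2_def)
  qed
  ultimately show ?thesis by (simp add: form_domain_def)
qed

lemma weak_partial_H1:
  assumes "u \<in> H1"
  shows "weak_partial i u \<in> L2" "is_weak_partial i u (weak_partial i u)"
proof -
  have "\<exists>g. g \<in> L2 \<and> is_weak_partial i u g" using assms by (auto simp: H1_def)
  from someI_ex[OF this] show "weak_partial i u \<in> L2" "is_weak_partial i u (weak_partial i u)"
    by (auto simp: weak_partial_def)
qed

text \<open>Since \<open>weak_partial\<close> is a choice, equality with the classical derivative
  holds only almost everywhere; both satisfy the same weak identity, so their difference is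
  annihilated by all test functions.\<close>

lemma weak_partial_test_function:
  fixes \<psi> :: "real ^ 'n \<Rightarrow> complex"
  assumes \<psi>: "\<psi> \<in> test_functions"
  shows "AE x in lborel. weak_partial i \<psi> x = partial i \<psi> x"
proof -
  have "\<psi> \<in> H1"
    unfolding H1_def using \<psi> by (blast intro: test_functions_L2 partial_test_functions test_function_is_weak_partial)
  note w = weak_partial_H1[OF this, of i]
  have l: "locally_integrable (weak_partial i \<psi>)" "locally_integrable (partial i \<psi>)"
    using w by (auto intro!: locally_integrable_L2 test_functions_L2 partial_test_functions \<psi>)
  have "AE x in lborel. weak_partial i \<psi> x - partial i \<psi> x = 0"
  proof (rule fundamental_lemma_calculus_of_variations)
    show "locally_integrable (\<lambda>x. weak_partial i \<psi> x - partial i \<psi> x)"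
      using l unfolding locally_integrable_def by auto
    fix \<eta> :: "real ^ 'n \<Rightarrow> complex" assume \<eta>: "\<eta> \<in> test_functions"
    have "(LINT x|lborel. weak_partial i \<psi> x * \<eta> x) = (LINT x|lborel. partial i \<psi> x * \<eta> x)"
      using w(2) test_function_is_weak_partial[OF \<psi>, of i] \<eta> by (simp add: is_weak_partial_def)
    then show "(LINT x|lborel. (weak_partial i \<psi> x - partial i \<psi> x) * \<eta> x) = 0"
      unfolding left_diff_distrib
      by (subst Bochner_Integration.integral_diff) (simp_all add: integrable_mult_test_function l \<eta>)
  qed
  then show ?thesis by simp
qed

text \<open>Removes the conjugate that the L^2 inner product puts on its second argument; the weak
  derivative is defined without one.\<close>

lemma cnj_partial_real:
  fixes \<rho> :: "real ^ 'n \<Rightarrow> real"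
  assumes "(\<lambda>x. complex_of_real (\<rho> x)) \<in> test_functions"
  shows "cnj (partial i (\<lambda>x. complex_of_real (\<rho> x)) x) = partial i (\<lambda>x. complex_of_real (\<rho> x)) x"
proof -
  have d: "((\<lambda>s. complex_of_real (\<rho> (x + s *\<^sub>R axis i 1))) has_vector_derivative
      partial i (\<lambda>x. complex_of_real (\<rho> x)) x) (at 0)"
    using test_function_line_derivative[OF assms, of x i 0] by simp
  have "((\<lambda>s. complex_of_real (\<rho> (x + s *\<^sub>R axis i 1))) has_vector_derivative
      cnj (partial i (\<lambda>x. complex_of_real (\<rho> x)) x)) (at 0)"
    using bounded_linear.has_vector_derivative[OF bounded_linear_cnj d]
    unfolding complex_cnj_complex_of_real .
  from vector_derivative_unique_at[OF this d] show ?thesis .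
qed

text \<open>Testing the form identity with test functions moves both derivatives onto the test function.\<close>

lemma schroedinger_distributional:
  fixes q \<phi> \<rho> :: "real ^ 'n \<Rightarrow> real" and E :: real
  defines "\<psi> \<equiv> \<lambda>x. complex_of_real (\<rho> x)"
  assumes s: "schroedinger q (\<lambda>x. complex_of_real (\<phi> x)) (\<lambda>x. complex_of_real E * complex_of_real (\<phi> x))"
    and q: "continuous_on UNIV q" "\<And>x. q x \<ge> 0" and \<phi>: "continuous_on UNIV \<phi>" and \<psi>: "\<psi> \<in> test_functions"
  shows "(\<Sum>i\<in>UNIV. LINT x|lborel. complex_of_real (\<phi> x) * partial i (partial i \<psi>) x) =
      complex_of_real (LINT x|lborel. (q x - E) * \<phi> x * \<rho> x)"
proof -
  let ?u = "\<lambda>x. complex_of_real (\<phi> x)"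
  have u: "?u \<in> H1" using s by (auto simp: schroedinger_def form_domain_def)
  have \<psi>H: "\<psi> \<in> form_domain q" by (rule test_functions_form_domain[OF \<psi> q])
  then have \<psi>1: "\<psi> \<in> H1" by (auto simp: form_domain_def)
  \<comment> \<open>Only the factor from \<psi> becomes classical. The derivative of
    \<open>?u\<close> stays weak, and its defining identity is applied to the test function
    \<open>partial i \<psi>\<close>.\<close>
  have g: "L2_inner (weak_partial i ?u) (weak_partial i \<psi>) = - (LINT x|lborel. ?u x * partial i (partial i \<psi>) x)" for i
  proof -
    have [measurable]: "weak_partial i ?u \<in> borel_measurable borel" "weak_partial i \<psi> \<in> borel_measurable borel"
        "partial i \<psi> \<in> borel_measurable borel"
      using weak_partial_H1(1)[OF u, of i] weak_partial_H1(1)[OF \<psi>1, of i]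
      by (auto simp: L2_def borel_measurable_test_function partial_test_functions \<psi>)
    have [measurable]: "(\<lambda>x. cnj (weak_partial i \<psi> x)) \<in> borel_measurable borel"
      by (rule borel_measurable_continuous_on[OF _ \<open>weak_partial i \<psi> \<in> _\<close>]) (intro continuous_intros)
    have "L2_inner (weak_partial i ?u) (weak_partial i \<psi>) = (LINT x|lborel. weak_partial i ?u x * partial i \<psi> x)"
      unfolding L2_inner_def
    proof (rule integral_cong_AE)
      show "AE x in lborel. weak_partial i ?u x * cnj (weak_partial i \<psi> x) = weak_partial i ?u x * partial i \<psi> x"
        using weak_partial_test_function[OF \<psi>, of i]
      proof eventually_elim
        case (elim x)
        have "cnj (partial i \<psi> x) = partial i \<psi> x"
          using cnj_partial_real[OF \<psi>[unfolded \<psi>_def]] unfolding \<psi>_def .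
        then show ?case by (simp only: elim)
      qed
    qed measurable
    also have "\<dots> = - (LINT x|lborel. ?u x * partial i (partial i \<psi>) x)"
      using weak_partial_H1(2)[OF u, of i] partial_test_functions[OF \<psi>, of i] by (simp add: is_weak_partial_def)
    finally show ?thesis .
  qed
  have iq: "integrable lborel (\<lambda>x. complex_of_real (q x * \<phi> x) * \<psi> x)"
    and iE: "integrable lborel (\<lambda>x. complex_of_real (E * \<phi> x) * \<psi> x)"
    using q \<phi> by (auto intro!: integrable_mult_test_function[OF locally_integrable_continuous \<psi>] continuous_intros)
  have lhs: "form q ?u \<psi> = L2_inner (\<lambda>x. complex_of_real E * ?u x) \<psi>"
    using s \<psi>H unfolding schroedinger_def by blast
  have "sqrt_mult q ?u x * cnj (sqrt_mult q \<psi> x) = complex_of_real (q x * \<phi> x) * \<psi> x" for x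
  proof -
    have "sqrt_mult q ?u x * cnj (sqrt_mult q \<psi> x) =
        complex_of_real ((sqrt (q x) * sqrt (q x)) * \<phi> x * \<rho> x)"
      by (simp only: sqrt_mult_def \<psi>_def of_real_mult complex_cnj_mult complex_cnj_complex_of_real mult_ac)
    also have "\<dots> = complex_of_real (q x * \<phi> x * \<rho> x)" using q(2)[of x] by simp
    finally show ?thesis by (simp only: \<psi>_def of_real_mult)
  qed
  then have qq: "L2_inner (sqrt_mult q ?u) (sqrt_mult q \<psi>) = (LINT x|lborel. complex_of_real (q x * \<phi> x) * \<psi> x)"
    by (simp only: L2_inner_def)
  have EE: "L2_inner (\<lambda>x. complex_of_real E * ?u x) \<psi> = (LINT x|lborel. complex_of_real (E * \<phi> x) * \<psi> x)"
    unfolding L2_inner_def \<psi>_def by (simp only: of_real_mult complex_cnj_complex_of_real)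
  have alg: "- a + b = c \<Longrightarrow> a = b - c" for a b c :: complex by auto
  have "(\<Sum>i\<in>UNIV. LINT x|lborel. ?u x * partial i (partial i \<psi>) x) =
      (LINT x|lborel. complex_of_real (q x * \<phi> x) * \<psi> x) - (LINT x|lborel. complex_of_real (E * \<phi> x) * \<psi> x)"
    by (rule alg) (use lhs in \<open>simp only: form_def g qq EE sum_negf\<close>)
  also have "\<dots> = (LINT x|lborel. complex_of_real ((q x - E) * \<phi> x * \<rho> x))"
    unfolding Bochner_Integration.integral_diff[OF iq iE, symmetric]
    by (simp only: \<psi>_def of_real_mult of_real_diff left_diff_distrib)
  finally show ?thesis by (simp only: integral_complex_of_real)
qed

subsection \<open>Viscosity supersolutions\<close>

text \<open>If w2 were negative, w1, which vanishes at the minimum, would be negative just to the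
  right of 0 and w would decrease there. The derivative of w1 is required only at 0.\<close>

lemma second_derivative_nonneg_at_local_min:
  fixes w :: "real \<Rightarrow> real"
  assumes \<delta>: "\<delta> > 0" and min: "\<And>t. \<bar>t\<bar> < \<delta> \<Longrightarrow> w 0 \<le> w t"
    and d1: "\<And>t. \<bar>t\<bar> < \<delta> \<Longrightarrow> (w has_real_derivative w1 t) (at t)"
    and d2: "(w1 has_real_derivative w2) (at 0)"
  shows "w2 \<ge> 0"
proof (rule ccontr)
  assume "\<not> w2 \<ge> 0"
  then have "w2 < 0" by simp
  from DERIV_neg_dec_right[OF d2 this] obtain e where e: "e > 0" "\<And>h. h > 0 \<Longrightarrow> h < e \<Longrightarrow> w1 h < w1 0"
    by auto
  have "w1 0 = 0"
    by (rule DERIV_local_min[OF d1[of 0] \<delta>]) (use \<delta> min in auto)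
  define b where "b = min e \<delta> / 2"
  have b: "b > 0" "b < e" "b < \<delta>" using e \<delta> by (auto simp: b_def)
  have "w b < w 0"
  proof (rule DERIV_neg_imp_decreasing_open[OF b(1)])
    fix x assume "0 < x" "x < b"
    then show "\<exists>y. DERIV w x :> y \<and> y < 0"
      using d1[of x] e(2)[of x] b \<open>w1 0 = 0\<close> by auto
  next
    show "continuous_on {0..b} w"
      using b by (intro continuous_at_imp_continuous_on ballI DERIV_isCont[OF d1]) auto
  qed
  with min[of b] b show False by simp
qed

lemma partial_shift:
  fixes f :: "real ^ 'n \<Rightarrow> complex"
  assumes "f \<in> test_functions"
  shows "partial i (\<lambda>y. f (y + z)) = (\<lambda>y. partial i f (y + z))"
proof
  fix y
  have f: "(f has_derivative frechet_derivative f (at (y + z))) (at (y + z))"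
    using test_functionsD(4)[OF assms] frechet_derivative_works by blast
  have "((\<lambda>y. y + z) has_derivative (\<lambda>h. h)) (at y)"
    by (auto intro!: derivative_eq_intros)
  from diff_chain_at[OF this f]
  have "((\<lambda>y. f (y + z)) has_derivative frechet_derivative f (at (y + z))) (at y)"
    by (simp add: o_def)
  then show "partial i (\<lambda>y. f (y + z)) y = partial i f (y + z)"
    by (simp add: partial_def frechet_derivative_at[symmetric])
qed

text \<open>Continuity of a mollification, so that minima over balls exist. A convergent sequence of
  shifts is bounded, hence all translated supports lie in one compact K.\<close>

lemma continuous_integral_test_function_shift:
  fixes u :: "real ^ 'n \<Rightarrow> complex"
  assumes u: "locally_integrable u" and f: "f \<in> test_functions"
  shows "continuous_on UNIV (\<lambda>x. LINT y|lborel. u y * f (y - x))"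
  unfolding continuous_on_sequentially o_def
proof (intro ballI allI impI)
  fix x :: "real ^ 'n" and X assume X: "(\<forall>n. X n \<in> UNIV) \<and> X \<longlonglongrightarrow> x"
  obtain B where B: "\<And>x. norm (f x) \<le> B" using test_functions_bounded[OF f] by blast
  obtain M where M: "\<And>n. norm (X n) \<le> M"
    using convergent_imp_Bseq[OF convergentI[of X x]] X by (auto simp: Bseq_def)
  define K where "K = (\<lambda>(y, t). y + t) ` (closure {x. f x \<noteq> 0} \<times> cball 0 M)"
  have K: "compact K"
    unfolding K_def split_def
    by (intro compact_continuous_image compact_Times test_functionsD f) (auto intro!: continuous_intros)
  have 0: "f (y - X n) = 0" if "y \<notin> K" for y n
  proof (rule test_functionsD(3)[OF f], rule)
    assume "y - X n \<in> closure {x. f x \<noteq> 0}"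
    then have "y \<in> K" unfolding K_def using M[of n]
      by (intro image_eqI[of _ _ "(y - X n, X n)"]) auto
    with that show False by simp
  qed
  have i: "integrable lborel (\<lambda>y. indicator K y *\<^sub>R u y)"
    using u K by (auto simp: locally_integrable_def set_integrable_def)
  have s: "integrable lborel (\<lambda>y. u y * f (y - z))" for z
    using integrable_mult_test_function_shift[OF u f, of "- z"] by simp
  show "(\<lambda>n. LINT y|lborel. u y * f (y - X n)) \<longlonglongrightarrow> (LINT y|lborel. u y * f (y - x))"
  proof (rule integral_dominated_convergence)
    show "integrable lborel (\<lambda>y. B * norm (indicator K y *\<^sub>R u y))"
      using i by (intro integrable_mult_right integrable_norm)
    show "AE y in lborel. (\<lambda>n. u y * f (y - X n)) \<longlonglongrightarrow> u y * f (y - x)"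
    proof (intro AE_I2 tendsto_mult tendsto_const)
      fix y
      have "isCont f (y - x)" using test_functionsD(1)[OF f] by (simp add: continuous_on_eq_continuous_at)
      then show "(\<lambda>n. f (y - X n)) \<longlonglongrightarrow> f (y - x)"
        by (rule isCont_tendsto_compose) (use X in \<open>auto intro: tendsto_diff\<close>)
    qed
    show "AE y in lborel. norm (u y * f (y - X n)) \<le> B * norm (indicator K y *\<^sub>R u y)" for n
    proof (intro AE_I2)
      fix y
      show "norm (u y * f (y - X n)) \<le> B * norm (indicator K y *\<^sub>R u y)"
        using 0[of y n] B[of "y - X n"] by (cases "y \<in> K") (auto simp: norm_mult mult.commute[of "norm (u y)"] intro: mult_right_mono)
    qed
  qed (intro borel_measurable_integrable s)+
qed

text \<open>Supplies the normalising constant of the mollifier: the bump is positive on a nonempty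
  open box, which has positive measure.\<close>

lemma integral_box_bump_pos:
  fixes a b :: "real ^ 'n"
  assumes "box a b \<noteq> {}"
  shows "integrable lborel (box_bump 1 a b)" "(LINT x|lborel. box_bump 1 a b x) > 0"
proof -
  have "integrable lborel (\<lambda>x. complex_of_real 1 * complex_of_real (box_bump 1 a b x))"
    by (intro integrable_mult_test_function box_bump_test_function locally_integrable_continuous continuous_intros) simp
  then show i: "integrable lborel (box_bump 1 a b)"
    by (simp add: complex_of_real_integrable_eq)
  have "(LINT x|lborel. box_bump 1 a b x) \<noteq> 0"
  proof
    assume "(LINT x|lborel. box_bump 1 a b x) = 0"
    then have "AE x in lborel. box_bump 1 a b x = 0"
      using integral_nonneg_eq_0_iff_AE[OF i] by (simp add: box_bump_nonneg)
    then have "AE x in lborel. x \<notin> box a b"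
      by eventually_elim (use box_bump_pos[of 1] in force)
    then have "box a b \<in> null_sets lborel"
      by (auto simp: AE_iff_null_sets)
    then have "emeasure lborel (box a b) = 0" by auto
    moreover have lt: "a \<bullet> i < b \<bullet> i" if "i \<in> Basis" for i
      using assms that by (simp add: box_ne_empty)
    then have "emeasure lborel (box a b) = ennreal (\<Prod>i\<in>Basis. (b - a) \<bullet> i)"
      by (intro emeasure_lborel_box less_imp_le)
    moreover have "(\<Prod>i\<in>Basis. (b - a) \<bullet> i) > 0"
      using lt by (intro prod_pos) (simp add: inner_diff_left)
    ultimately show False by (metis ennreal_eq_0_iff not_le)
  qed
  moreover have "(LINT x|lborel. box_bump 1 a b x) \<ge> 0"
    by (intro Bochner_Integration.integral_nonneg box_bump_nonneg)
  ultimately show "(LINT x|lborel. box_bump 1 a b x) > 0" by simp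
qed

text \<open>At a minimum of the difference between a mollification of \<open>\<phi>\<close> and \<open>P\<close> the second
  derivatives along the axes are nonnegative, and those of the mollification are integrals of \<open>\<phi>\<close>
  against a translated test function. Adding \<open>\<kappa> |x - x0|\<^sup>2\<close> makes the minimum of \<open>\<phi> - P\<close> strict,
  so that it survives mollification.\<close>

lemma viscosity_supersolution:
  fixes \<phi> P W :: "real ^ 'n \<Rightarrow> real" and P1 P2 :: "'n \<Rightarrow> real ^ 'n \<Rightarrow> real"
  assumes \<phi>: "continuous_on UNIV \<phi>" and W: "continuous_on UNIV W"
    and weak: "\<And>\<rho>. (\<lambda>x. complex_of_real (\<rho> x)) \<in> test_functions \<Longrightarrow>
      (\<Sum>i\<in>UNIV. LINT x|lborel. complex_of_real (\<phi> x) * partial i (partial i (\<lambda>x. complex_of_real (\<rho> x))) x) =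
        complex_of_real (LINT x|lborel. W x * \<rho> x)"
    and S: "open S" "x0 \<in> S" and P: "continuous_on S P"
    and d1: "\<And>i x. x \<in> S \<Longrightarrow> ((\<lambda>t. P (x + t *\<^sub>R axis i 1)) has_real_derivative P1 i x) (at 0)"
    and d2: "\<And>i x. x \<in> S \<Longrightarrow> ((\<lambda>t. P1 i (x + t *\<^sub>R axis i 1)) has_real_derivative P2 i x) (at 0)"
    and min: "\<And>x. x \<in> S \<Longrightarrow> \<phi> x0 - P x0 \<le> \<phi> x - P x"
    and A: "\<And>x. x \<in> S \<Longrightarrow> A \<le> (\<Sum>i\<in>UNIV. P2 i x)" and B: "\<And>x. x \<in> S \<Longrightarrow> W x \<le> B"
  shows "A \<le> B"
proof (rule field_le_epsilon)
  fix \<kappa>' :: real assume "\<kappa>' > 0"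
  \<comment> \<open>The quadratic term adds 2 \<kappa> to each second derivative, hence \<kappa>' in
    total over all coordinates.\<close>
  define \<kappa> where "\<kappa> = \<kappa>' / (2 * real CARD('n))"
  have \<kappa>: "\<kappa> > 0" using \<open>\<kappa>' > 0\<close> by (simp add: \<kappa>_def)
  obtain r0 where r0: "r0 > 0" "cball x0 r0 \<subseteq> S" using S open_contains_cball by blast
  define r where "r = r0 / 2"
  have r: "r > 0" using r0 by (simp add: r_def)
  \<comment> \<open>On the sphere of radius r the quadratic term is 3 \<eta>, while mollification
    changes the values at the centre and on the sphere by at most \<eta> each. Halving r0 keeps the
    mollifier supports, of radius at most r, inside the larger ball.\<close>
  define \<eta> where "\<eta> = \<kappa> * r\<^sup>2 / 3"
  have \<eta>: "\<eta> > 0" using \<kappa> r by (simp add: \<eta>_def)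
  have "uniformly_continuous_on (cball x0 r0) \<phi>"
    using \<phi> by (intro compact_uniformly_continuous) (auto intro: continuous_on_subset)
  then obtain \<delta>0 where \<delta>0: "\<delta>0 > 0"
    "\<And>x y. x \<in> cball x0 r0 \<Longrightarrow> y \<in> cball x0 r0 \<Longrightarrow> dist y x < \<delta>0 \<Longrightarrow> dist (\<phi> y) (\<phi> x) < \<eta>"
    using \<eta> unfolding uniformly_continuous_on_def by metis
  \<comment> \<open>A cube of half-width \<delta> lies in a ball of radius n \<delta> by the l1
    bound on the norm, and n \<delta> is half of the permitted radius.\<close>
  define \<delta> where "\<delta> = Min {\<delta>0, r} / (2 * real CARD('n))"
  have \<delta>: "\<delta> > 0" using \<delta>0(1) r by (simp add: \<delta>_def)
  define a :: "real ^ 'n" where "a = (\<chi> i. \<delta>)"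
  have "box (- a) a \<noteq> {}"
    using \<delta> by (auto simp: a_def mem_box_cart intro!: exI[of _ 0] simp flip: ex_in_conv)
  note \<beta>i = integral_box_bump_pos[OF this]
  have box: "norm z < \<delta>0" "norm z \<le> r" if "z \<in> box (- a) a" for z
  proof -
    have "norm z \<le> (\<Sum>i\<in>UNIV. \<bar>z $ i\<bar>)" by (rule norm_le_l1_cart)
    also have "\<dots> \<le> (\<Sum>i\<in>(UNIV :: 'n set). \<delta>)"
      using that by (intro sum_mono) (auto simp: a_def mem_box_cart abs_le_iff less_imp_le minus_le_iff)
    also have "\<dots> = Min {\<delta>0, r} / 2" by (simp add: \<delta>_def)
    also have "\<dots> < Min {\<delta>0, r}" using \<delta>0(1) r by (auto simp: min_def)
    finally show "norm z < \<delta>0" "norm z \<le> r" by auto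
  qed
  define \<beta> where "\<beta> = box_bump 1 (- a) a"
  define N where "N = (LINT x|lborel. \<beta> x)"
  have N: "N > 0" using \<beta>i by (simp add: N_def \<beta>_def)
  define u where "u = (\<lambda>x. complex_of_real (\<phi> x))"
  define f where "f = (\<lambda>x. complex_of_real (\<beta> x))"
  have f: "f \<in> test_functions" unfolding f_def \<beta>_def by (rule box_bump_test_function) simp
  note f' = partial_test_functions[OF f] and f'' = partial_test_functions[OF partial_test_functions[OF f]]
  have u: "locally_integrable u" unfolding u_def by (intro locally_integrable_continuous continuous_intros \<phi>)
  define U where "U x = (LINT y|lborel. \<phi> y * \<beta> (y - x))" for x
  have cU: "complex_of_real (U x) = (LINT y|lborel. u y * f (y - x))" for x
    unfolding U_def u_def f_def by (simp flip: integral_complex_of_real)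
  have int\<beta>: "integrable lborel (\<lambda>y. \<beta> (y - x))" "(LINT y|lborel. \<beta> (y - x)) = N" for x
  proof -
    have "integrable lborel (\<lambda>y. complex_of_real 1 * f (y + (- x)))"
      by (intro integrable_mult_test_function_shift locally_integrable_continuous continuous_intros f)
    then show "integrable lborel (\<lambda>y. \<beta> (y - x))" by (simp add: f_def complex_of_real_integrable_eq)
    have "\<beta> \<in> borel_measurable borel"
      using borel_measurable_integrable[OF \<beta>i(1)] by (simp add: \<beta>_def)
    from lborel_integral_shift[OF this, of "- x"] show "(LINT y|lborel. \<beta> (y - x)) = N"
      by (simp add: N_def)
  qed
  have int\<phi>\<beta>: "integrable lborel (\<lambda>y. \<phi> y * \<beta> (y - x))" for x
  proof -
    have "integrable lborel (\<lambda>y. u y * f (y + (- x)))"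
      by (intro integrable_mult_test_function_shift u f)
    then show ?thesis by (simp add: u_def f_def complex_of_real_integrable_eq flip: of_real_mult)
  qed
  have close: "\<bar>U x / N - \<phi> x\<bar> \<le> \<eta>" if x: "x \<in> cball x0 r" for x
  proof -
    have 1: "\<beta> (y - x) * (\<phi> x - \<eta>) \<le> \<phi> y * \<beta> (y - x) \<and> \<phi> y * \<beta> (y - x) \<le> \<beta> (y - x) * (\<phi> x + \<eta>)" for y
    proof (cases "y - x \<in> box (- a) a")
      case True
      have "dist x0 y \<le> r0"
        using box(2)[OF True] x dist_triangle[of x0 y x] by (simp add: r_def dist_norm norm_minus_commute)
      moreover have "dist x0 x \<le> r0" using x r by (simp add: r_def)
      ultimately have "dist (\<phi> y) (\<phi> x) < \<eta>"
        using box(1)[OF True] by (intro \<delta>0(2)) (auto simp: dist_norm)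
      then have "\<phi> x - \<eta> \<le> \<phi> y" "\<phi> y \<le> \<phi> x + \<eta>" by (auto simp: dist_real_def)
      moreover have "\<beta> (y - x) \<ge> 0" by (simp add: \<beta>_def box_bump_nonneg)
      ultimately show ?thesis by (simp add: mult.commute[of "\<phi> y"] mult_left_mono)
    qed (simp add: \<beta>_def box_bump_eq_0)
    have "(LINT y|lborel. \<beta> (y - x) * (\<phi> x - \<eta>)) \<le> U x"
      unfolding U_def using 1 int\<phi>\<beta> int\<beta> by (intro integral_mono) auto
    moreover have "U x \<le> (LINT y|lborel. \<beta> (y - x) * (\<phi> x + \<eta>))"
      unfolding U_def using 1 int\<phi>\<beta> int\<beta> by (intro integral_mono) auto
    ultimately have "N * (\<phi> x - \<eta>) \<le> U x" "U x \<le> N * (\<phi> x + \<eta>)" using int\<beta> by auto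
    then have "\<phi> x - \<eta> \<le> U x / N" "U x / N \<le> \<phi> x + \<eta>"
      using N by (auto simp: field_simps)
    then show ?thesis by (simp add: abs_le_iff)
  qed
  define F where "F x = U x / N - P x + \<kappa> * (norm (x - x0))\<^sup>2" for x
  have rr: "cball x0 r \<subseteq> cball x0 r0" using r by (auto simp: r_def)
  have "continuous_on UNIV (\<lambda>x. Re (LINT y|lborel. u y * f (y - x)))"
    by (intro continuous_intros continuous_integral_test_function_shift u f)
  then have "continuous_on UNIV U" by (simp flip: cU)
  then have "continuous_on (cball x0 r) F"
    unfolding F_def using N rr r0(2)
    by (intro continuous_intros) (auto intro: continuous_on_subset continuous_on_subset[OF P])
  moreover have "cball x0 r \<noteq> {}" using r by simp
  ultimately obtain x1 where x1: "x1 \<in> cball x0 r" "\<And>x. x \<in> cball x0 r \<Longrightarrow> F x1 \<le> F x"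
    using continuous_attains_inf[OF compact_cball] by blast
  \<comment> \<open>On the sphere F is at least \<phi>(x0) - P(x0) + 2 \<eta>, whereas F(x0) is at
    most \<phi>(x0) - P(x0) + \<eta>; so the minimum is interior.\<close>
  have x1b: "dist x0 x1 < r"
  proof (rule ccontr)
    assume "\<not> dist x0 x1 < r"
    with x1(1) have "norm (x1 - x0) = r" by (simp add: dist_norm norm_minus_commute)
    then have "F x1 = U x1 / N - P x1 + 3 * \<eta>" by (simp add: F_def \<eta>_def)
    moreover have "U x1 / N \<ge> \<phi> x1 - \<eta>" using close[OF x1(1)] by (simp add: abs_le_iff)
    moreover have "\<phi> x0 - P x0 \<le> \<phi> x1 - P x1" using x1(1) rr r0(2) by (intro min) auto
    moreover have "F x0 \<le> \<phi> x0 + \<eta> - P x0" using close[of x0] r by (simp add: F_def abs_le_iff)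
    moreover have "F x1 \<le> F x0" using r by (intro x1(2)) simp
    ultimately show False using \<eta> by simp
  qed
  define D where "D i = (LINT y|lborel. u y * partial i (partial i f) (y - x1))" for i
  have second: "Re (D i) / N - P2 i x1 + 2 * \<kappa> \<ge> 0" for i
  proof -
    let ?e = "axis i 1 :: real ^ 'n"
    define G where "G t = Re (- (LINT y|lborel. u y * partial i f (y - (x1 + t *\<^sub>R ?e))))" for t
    have U1: "((\<lambda>t. U (x1 + t *\<^sub>R ?e)) has_real_derivative
        G t) (at t)" for t
    proof -
      have "((\<lambda>t. - t) has_vector_derivative - 1) (at t)" by (auto intro!: derivative_eq_intros)
      from vector_diff_chain_at[OF this has_vector_derivative_integral_test_function[OF u f, of "- x1" i "- t"]]
      have "((\<lambda>t. complex_of_real (U (x1 + t *\<^sub>R ?e))) has_vector_derivative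
        - (LINT y|lborel. u y * partial i f (y - (x1 + t *\<^sub>R ?e)))) (at t)"
        by (simp add: o_def cU algebra_simps)
      from bounded_linear.has_vector_derivative[OF bounded_linear_Re this] show ?thesis
        by (simp add: G_def has_real_derivative_iff_has_vector_derivative)
    qed
    have U2: "(G has_real_derivative Re (D i)) (at 0)"
    proof -
      have "((\<lambda>t. - t) has_vector_derivative - 1) (at (0::real))" by (auto intro!: derivative_eq_intros)
      from vector_diff_chain_at[OF this has_vector_derivative_integral_test_function[OF u f', of i "- x1" i "- 0"]]
      have "((\<lambda>t. LINT y|lborel. u y * partial i f (y - (x1 + t *\<^sub>R ?e))) has_vector_derivative - D i) (at 0)"
        by (simp add: o_def D_def algebra_simps)
      from bounded_linear.has_vector_derivative[OF bounded_linear_Re has_vector_derivative_minus[OF this]] show ?thesis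
        by (simp add: G_def[abs_def] has_real_derivative_iff_has_vector_derivative)
    qed
    \<comment> \<open>Along an axis the quadratic term is a polynomial in t, which can be
      differentiated even where the norm cannot.\<close>
    have sq: "(norm (x1 + t *\<^sub>R ?e - x0))\<^sup>2 = (norm (x1 - x0))\<^sup>2 + 2 * t * (x1 - x0) $ i + t\<^sup>2" for t
    proof -
      have "x1 + t *\<^sub>R ?e - x0 = (x1 - x0) + t *\<^sub>R ?e" by simp
      then show ?thesis
        by (simp only: power2_norm_eq_inner inner_add_left inner_add_right)
          (simp add: inner_axis inner_axis' power2_eq_square)
    qed
    define w where "w t = U (x1 + t *\<^sub>R ?e) / N - P (x1 + t *\<^sub>R ?e) + \<kappa> * ((norm (x1 - x0))\<^sup>2 + 2 * t * (x1 - x0) $ i + t\<^sup>2)" for t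
    define w1 where "w1 t = G t / N - P1 i (x1 + t *\<^sub>R ?e) + \<kappa> * (2 * (x1 - x0) $ i + 2 * t)" for t
    have wF: "w t = F (x1 + t *\<^sub>R ?e)" for t by (simp add: w_def F_def sq)
    have inb: "x1 + t *\<^sub>R ?e \<in> cball x0 r" if "\<bar>t\<bar> < r - dist x0 x1" for t
    proof -
      have "dist x0 (x1 + t *\<^sub>R ?e) \<le> dist x0 x1 + dist x1 (x1 + t *\<^sub>R ?e)" by (rule dist_triangle)
      also have "dist x1 (x1 + t *\<^sub>R ?e) = \<bar>t\<bar>" by (simp add: dist_norm norm_axis_1)
      finally show ?thesis using that by simp
    qed
    show ?thesis
    proof (rule second_derivative_nonneg_at_local_min)
      show "r - dist x0 x1 > 0" using x1b by simp
      show "w 0 \<le> w t" if "\<bar>t\<bar> < r - dist x0 x1" for t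
        using x1(2)[OF inb[OF that]] by (simp add: wF)
      show "(w has_real_derivative w1 t) (at t)" if "\<bar>t\<bar> < r - dist x0 x1" for t
      proof -
        \<comment> \<open>\<open>d1\<close> gives derivatives at parameter 0 only; with base point
          shifted by t along the axis it yields the derivative at t.\<close>
        have "x1 + t *\<^sub>R ?e \<in> S" using inb[OF that] rr r0(2) by blast
        from d1[OF this, of i] have "((\<lambda>s. P (x1 + (s + t) *\<^sub>R ?e)) has_real_derivative P1 i (x1 + t *\<^sub>R ?e)) (at 0)"
          by (simp add: algebra_simps)
        then have "((\<lambda>s. P (x1 + s *\<^sub>R ?e)) has_real_derivative P1 i (x1 + t *\<^sub>R ?e)) (at t)"
          using DERIV_shift[of "\<lambda>s. P (x1 + s *\<^sub>R ?e)" _ 0 t] by simp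
        then show ?thesis
          unfolding w_def w1_def using N by (auto intro!: derivative_eq_intros U1)
      qed
      have "x1 \<in> S" using x1(1) rr r0(2) by blast
      from d2[OF this, of i]
      show "(w1 has_real_derivative Re (D i) / N - P2 i x1 + 2 * \<kappa>) (at 0)"
        unfolding w1_def by (auto intro!: derivative_eq_intros U2 simp: N less_imp_neq[OF N, symmetric])
    qed
  qed
  have "(\<Sum>i\<in>UNIV. D i) = complex_of_real (LINT y|lborel. W y * \<beta> (y - x1))"
  proof -
    have eq: "(\<lambda>y. complex_of_real (\<beta> (y - x1))) = (\<lambda>y. f (y + (- x1)))" by (simp add: f_def)
    \<comment> \<open>A translated box bump is the bump of the translated box, hence a test function
      to which \<open>weak\<close> applies.\<close>
    have eq': "(\<lambda>y. complex_of_real (\<beta> (y - x1))) = (\<lambda>y. complex_of_real (box_bump 1 (x1 - a) (x1 + a) y))"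
      by (auto simp: \<beta>_def box_bump_def bump_def algebra_simps intro!: ext prod.cong)
    have t: "(\<lambda>y. complex_of_real (\<beta> (y - x1))) \<in> test_functions"
      unfolding eq' by (rule box_bump_test_function) simp
    have "partial i (partial i (\<lambda>y. complex_of_real (\<beta> (y - x1)))) = (\<lambda>y. partial i (partial i f) (y + (- x1)))" for i
      unfolding eq by (simp only: partial_shift f f')
    with weak[OF t] show ?thesis by (simp add: D_def u_def)
  qed
  then have "(\<Sum>i\<in>UNIV. Re (D i)) = (LINT y|lborel. W y * \<beta> (y - x1))"
    by (metis Re_complex_of_real Re_sum)
  also have "\<dots> \<le> (LINT y|lborel. B * \<beta> (y - x1))"
  proof (rule integral_mono)
    have "integrable lborel (\<lambda>y. complex_of_real (W y) * f (y + (- x1)))"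
      by (intro integrable_mult_test_function_shift locally_integrable_continuous continuous_intros W f)
    then show "integrable lborel (\<lambda>y. W y * \<beta> (y - x1))"
      by (simp add: f_def complex_of_real_integrable_eq flip: of_real_mult)
    show "integrable lborel (\<lambda>y. B * \<beta> (y - x1))" using int\<beta> by auto
    fix y
    show "W y * \<beta> (y - x1) \<le> B * \<beta> (y - x1)"
    proof (cases "y - x1 \<in> box (- a) a")
      case True
      have "dist x0 y \<le> r0"
        using box(2)[OF True] x1(1) dist_triangle[of x0 y x1] by (simp add: r_def dist_norm norm_minus_commute)
      then have "W y \<le> B" using r0(2) by (intro B) auto
      then show ?thesis by (intro mult_right_mono) (auto simp: \<beta>_def box_bump_nonneg)
    qed (simp add: \<beta>_def box_bump_eq_0)
  qed
  also have "\<dots> = B * N" using int\<beta> by simp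
  finally have DB: "(\<Sum>i\<in>UNIV. Re (D i)) / N \<le> B" using N by (simp add: field_simps)
  have "0 \<le> (\<Sum>i\<in>UNIV. Re (D i) / N - P2 i x1 + 2 * \<kappa>)" using second by (intro sum_nonneg) auto
  also have "\<dots> = (\<Sum>i\<in>UNIV. Re (D i)) / N - (\<Sum>i\<in>UNIV. P2 i x1) + \<kappa>'"
    by (simp add: sum.distrib sum_subtractf sum_divide_distrib \<kappa>_def)
  also have "\<dots> \<le> B - A + \<kappa>'"
    using DB A[of x1] subsetD[OF r0(2) subsetD[OF rr x1(1)]] by simp
  finally show "A \<le> B + \<kappa>'" by simp
qed

subsection \<open>The radial barrier\<close>

lemma norm_line_derivative:
  fixes x :: "real ^ 'n"
  assumes "x \<noteq> 0"
  shows "((\<lambda>t. norm (x + t *\<^sub>R axis i 1)) has_real_derivative x $ i / norm x) (at 0)"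
proof -
  have eq: "norm (x + t *\<^sub>R axis i 1) = sqrt ((norm x)\<^sup>2 + 2 * t * x $ i + t\<^sup>2)" for t
    by (simp add: norm_eq_sqrt_inner inner_add_left inner_add_right inner_axis inner_axis' power2_eq_square algebra_simps)
  show ?thesis
    unfolding eq using assms by (auto intro!: derivative_eq_intros simp: field_simps)
qed

definition barrier :: "(real \<Rightarrow> real) \<Rightarrow> real ^ 'n \<Rightarrow> real" where
  "barrier J x = exp (- 2 * J (norm x))"

text \<open>The functions \<open>s\<close> and \<open>s'\<close> stand for J' and J''; the formula
  is the derivative of \<open>barrier J\<close> along the i-th axis.\<close>

definition barrier_deriv1 :: "(real \<Rightarrow> real) \<Rightarrow> (real \<Rightarrow> real) \<Rightarrow> 'n \<Rightarrow> real ^ 'n \<Rightarrow> real" where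
  "barrier_deriv1 J s i x = - 2 * s (norm x) * (x $ i / norm x) * barrier J x"

text \<open>The first summand is the square of the logarithmic derivative of the barrier, the second
  is the derivative of that logarithmic derivative; 1/r - x_i^2/r^3 is the derivative of x_i/r along
  the axis.\<close>

definition barrier_deriv2 ::
    "(real \<Rightarrow> real) \<Rightarrow> (real \<Rightarrow> real) \<Rightarrow> (real \<Rightarrow> real) \<Rightarrow> 'n \<Rightarrow> real ^ 'n \<Rightarrow> real" where
  "barrier_deriv2 J s s' i x =
    (4 * (s (norm x))\<^sup>2 * (x $ i)\<^sup>2 / (norm x)\<^sup>2
      - 2 * (s' (norm x) * (x $ i)\<^sup>2 / (norm x)\<^sup>2 + s (norm x) * (1 / norm x - (x $ i)\<^sup>2 / norm x ^ 3)))
    * barrier J x"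

lemma barrier_line_derivative:
  fixes x :: "real ^ 'n"
  assumes "x \<noteq> 0" "(J has_real_derivative s (norm x)) (at (norm x))"
  shows "((\<lambda>t. barrier J (x + t *\<^sub>R axis i 1)) has_real_derivative barrier_deriv1 J s i x) (at 0)"
proof -
  have "((\<lambda>t. J (norm (x + t *\<^sub>R axis i 1))) has_real_derivative s (norm x) * (x $ i / norm x)) (at 0)"
    by (rule DERIV_chain2[OF _ norm_line_derivative]) (use assms in auto)
  then show ?thesis
    unfolding barrier_def barrier_deriv1_def by (auto intro!: derivative_eq_intros)
qed

lemma barrier_deriv1_line_derivative:
  fixes x :: "real ^ 'n"
  assumes x: "x \<noteq> 0" and J: "(J has_real_derivative s (norm x)) (at (norm x))"
    and s: "(s has_real_derivative s' (norm x)) (at (norm x))"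
  shows "((\<lambda>t. barrier_deriv1 J s i (x + t *\<^sub>R axis i 1)) has_real_derivative barrier_deriv2 J s s' i x) (at 0)"
proof -
  define r where "r = norm x"
  have r: "r > 0" using x by (simp add: r_def)
  have 1: "((\<lambda>t. s (norm (x + t *\<^sub>R axis i 1))) has_real_derivative s' r * (x $ i / r)) (at 0)"
    unfolding r_def by (rule DERIV_chain2[OF _ norm_line_derivative]) (use s x in auto)
  have 2: "((\<lambda>t. barrier J (x + t *\<^sub>R axis i 1)) has_real_derivative - 2 * s r * (x $ i / r) * barrier J x) (at 0)"
    using barrier_line_derivative[of x J s i, OF x J] by (simp add: barrier_deriv1_def r_def)
  have 3: "((\<lambda>t. (x + t *\<^sub>R axis i 1) $ i / norm (x + t *\<^sub>R axis i 1)) has_real_derivative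
      1 / r - (x $ i)\<^sup>2 / r ^ 3) (at 0)"
    unfolding r_def using x
    by (auto intro!: derivative_eq_intros norm_line_derivative simp: field_simps power2_eq_square power3_eq_cube)
  show ?thesis
    unfolding barrier_deriv1_def barrier_deriv2_def
    by (rule derivative_eq_intros refl 1 2 3)+
      (simp add: r_def[symmetric] algebra_simps power2_eq_square power3_eq_cube)
qed

text \<open>The sum of the x_i^2 is |x|^2, which leaves the radial Laplacian g'' + (n - 1) g'/r of g
  = exp(-2 J).\<close>

lemma sum_barrier_deriv2:
  fixes x :: "real ^ 'n"
  assumes "x \<noteq> 0"
  shows "(\<Sum>i\<in>UNIV. barrier_deriv2 J s s' i x) =
    (4 * (s (norm x))\<^sup>2 - 2 * s' (norm x) - 2 * s (norm x) * (real CARD('n) - 1) / norm x) * barrier J x"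
proof -
  have sq: "(\<Sum>i\<in>UNIV. (x $ i)\<^sup>2) = (norm x)\<^sup>2"
    by (simp add: norm_vec_def L2_set_def sum_nonneg)
  have "(\<Sum>i\<in>UNIV. barrier_deriv2 J s s' i x) =
    (4 * (s (norm x))\<^sup>2 * (\<Sum>i\<in>UNIV. (x $ i)\<^sup>2) / (norm x)\<^sup>2
      - 2 * (s' (norm x) * (\<Sum>i\<in>UNIV. (x $ i)\<^sup>2) / (norm x)\<^sup>2
          + s (norm x) * (real CARD('n) / norm x - (\<Sum>i\<in>UNIV. (x $ i)\<^sup>2) / norm x ^ 3))) * barrier J x"
    unfolding barrier_deriv2_def
    by (simp add: sum_distrib_left sum_distrib_right sum_divide_distrib sum.distrib sum_subtractf algebra_simps)
  then show ?thesis
    unfolding sq using assms by (simp add: field_simps power2_eq_square power3_eq_cube)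
qed

section \<open>Growth of the iterated logarithms and of \<open>f_log\<close>\<close>

lemma iterated_ln_at_top: "filterlim ((ln :: real \<Rightarrow> real) ^^ p) at_top at_top"
proof (induction p)
  case (Suc p)
  then show ?case
    using filterlim_compose[OF ln_at_top Suc] by (simp add: o_def)
qed (simp add: filterlim_ident id_def)

text \<open>For large t all iterates up to order j are at least 1, so the product and the exponent k
  can only enlarge the last iterate, and \<open>f_log\<close> dominates it.\<close>

lemma f_log_at_top:
  assumes "k \<ge> 1"
  shows "filterlim (f_log k j) at_top at_top"
proof (rule filterlim_at_top_mono[OF iterated_ln_at_top[of j]])
  have "eventually (\<lambda>t. 1 \<le> (ln ^^ p) (t :: real)) at_top" for p
    using iterated_ln_at_top[of p] unfolding filterlim_at_top by blast
  then have "eventually (\<lambda>t. \<forall>p\<in>{..j}. 1 \<le> (ln ^^ p) (t :: real)) at_top"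
    by (intro eventually_ball_finite) auto
  then show "eventually (\<lambda>t. (ln ^^ j) t \<le> f_log k j t) at_top"
  proof eventually_elim
    case (elim t)
    then have 1: "1 \<le> (ln ^^ j) t" and "1 \<le> (\<Prod>p<j. (ln ^^ p) t)"
      by (auto intro!: prod_ge_1)
    moreover have "(ln ^^ j) t powr 1 \<le> (ln ^^ j) t powr k"
      using 1 assms by (intro powr_mono) auto
    ultimately show ?case
      unfolding f_log_def using mult_mono[of "(ln ^^ j) t" "(ln ^^ j) t powr k" 1 "\<Prod>p<j. (ln ^^ p) t"] by simp
  qed
qed

text \<open>\<open>W\<close> stands for (q - E) \<phi>, and \<open>sub\<close> makes 3 s^2 a lower
  bound for the quotient of the Laplacian of the barrier by the barrier. The gap between 2 in
  \<open>W_le\<close> and 3 in \<open>sub\<close> drives the contradiction; \<open>J_lower\<close>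
  makes the barrier decay, so that a positive maximum over the unbounded exterior is
  attained.\<close>

lemma ground_state_lower_bound:
  fixes \<phi> W :: "real ^ 'n \<Rightarrow> real" and J s s' :: "real \<Rightarrow> real"
  assumes \<phi>: "continuous_on UNIV \<phi>" "\<And>x. \<phi> x > 0" and W: "continuous_on UNIV W"
    and weak: "\<And>\<rho>. (\<lambda>x. complex_of_real (\<rho> x)) \<in> test_functions \<Longrightarrow>
      (\<Sum>i\<in>UNIV. LINT x|lborel. complex_of_real (\<phi> x) * partial i (partial i (\<lambda>x. complex_of_real (\<rho> x))) x) =
        complex_of_real (LINT x|lborel. W x * \<rho> x)"
    and R: "R > 0"
    and J: "\<And>r. r \<ge> R \<Longrightarrow> (J has_real_derivative s r) (at r)"
    and s: "\<And>r. r \<ge> R \<Longrightarrow> (s has_real_derivative s' r) (at r)"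
    and J_lower: "\<And>r. r \<ge> R \<Longrightarrow> r\<^sup>2 / 2 \<le> J r"
    and sub: "\<And>r. r \<ge> R \<Longrightarrow> 3 * (s r)\<^sup>2 \<le> 4 * (s r)\<^sup>2 - 2 * s' r - 2 * s r * (real CARD('n) - 1) / r"
    and pos: "\<And>r. r \<ge> R \<Longrightarrow> s r > 0"
    and W_le: "\<And>x. norm x \<ge> R \<Longrightarrow> W x \<le> 2 * (s (norm x))\<^sup>2 * \<phi> x"
  shows "\<exists>c>0. \<forall>x. norm x \<ge> R \<longrightarrow> c * exp (- 2 * J (norm x)) \<le> \<phi> x"
proof -
  have "(cball 0 R :: (real ^ 'n) set) \<noteq> {}" using R by simp
  then obtain z where z: "\<And>x. x \<in> cball 0 R \<Longrightarrow> \<phi> z \<le> \<phi> x"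
    using continuous_attains_inf[OF compact_cball _ continuous_on_subset[OF \<phi>(1) subset_UNIV]] by metis
  \<comment> \<open>With this c the barrier equals the minimum of \<phi> over the closed ball on the
    sphere of radius R, so the maximum cannot lie there.\<close>
  define c where "c = \<phi> z * exp (2 * J R)"
  have c: "c > 0" using \<phi>(2) by (simp add: c_def)
  define h :: "real ^ 'n \<Rightarrow> real" where "h x = c * barrier J x" for x
  have h_pos: "h x > 0" for x using c by (simp add: h_def barrier_def)
  have Jc: "continuous_on {x :: real ^ 'n. R \<le> norm x} (\<lambda>x. J (norm x))"
    by (rule continuous_on_compose2[of "{R..}" J])
      (auto intro!: continuous_at_imp_continuous_on DERIV_isCont J continuous_intros)
  have sc: "continuous_on {x :: real ^ 'n. R \<le> norm x} (\<lambda>x. s (norm x))"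
    by (rule continuous_on_compose2[of "{R..}" s])
      (auto intro!: continuous_at_imp_continuous_on DERIV_isCont s continuous_intros)
  have hc: "continuous_on {x. R \<le> norm x} h"
    unfolding h_def barrier_def by (intro continuous_intros Jc)
  have "h x \<le> \<phi> x" if x: "norm x \<ge> R" for x
  proof (rule ccontr)
    assume "\<not> h x \<le> \<phi> x"
    define \<eta> where "\<eta> = h x - \<phi> x"
    have \<eta>: "\<eta> > 0" using \<open>\<not> h x \<le> \<phi> x\<close> by (simp add: \<eta>_def)
    \<comment> \<open>A superlevel set of h - \<phi>. As \<phi> > 0, h is at least \<eta> on it, and
      the decay of h bounds it; being closed as well, it is compact.\<close>
    define T where "T = {x. R \<le> norm x} \<inter> (\<lambda>x. h x - \<phi> x) -` {\<eta>..}"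
    have T_bound: "norm y \<le> c / \<eta>" if "y \<in> T" for y
    proof -
      have y: "norm y \<ge> R" "\<eta> \<le> h y" using that \<phi>(2)[of y] by (auto simp: T_def)
      have "norm y \<le> 1 + (norm y)\<^sup>2"
      proof -
        have "0 \<le> (norm y)\<^sup>2 + 1 - 2 * norm y"
          using zero_le_power2[of "norm y - 1"] by (simp add: power2_diff)
        with norm_ge_zero[of y] show ?thesis by linarith
      qed
      also have "\<dots> \<le> exp ((norm y)\<^sup>2)" by (rule exp_ge_add_one_self)
      also have "\<dots> \<le> exp (2 * J (norm y))" using J_lower[OF y(1)] by simp
      also have "\<dots> \<le> c / \<eta>"
        using y(2) \<eta> by (simp add: h_def barrier_def field_simps exp_minus)
      finally show ?thesis .
    qed
    have cont: "continuous_on {x. R \<le> norm x} (\<lambda>x. h x - \<phi> x)"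
      by (intro continuous_intros hc continuous_on_subset[OF \<phi>(1)]) auto
    have "closed {x :: real ^ 'n. R \<le> norm x}"
      by (intro closed_Collect_le continuous_intros)
    from continuous_closed_preimage[OF cont this closed_atLeast] have "closed T"
      by (simp add: T_def)
    moreover have "bounded T" using T_bound by (auto simp: bounded_iff)
    ultimately have "compact T" by (simp add: compact_eq_bounded_closed)
    moreover have "x \<in> T" using x by (simp add: T_def \<eta>_def)
    moreover have "continuous_on T (\<lambda>x. h x - \<phi> x)"
      by (rule continuous_on_subset[OF cont]) (auto simp: T_def)
    ultimately obtain x0 where x0: "x0 \<in> T" "\<And>y. y \<in> T \<Longrightarrow> h y - \<phi> y \<le> h x0 - \<phi> x0"
      using continuous_attains_sup[of T "\<lambda>x. h x - \<phi> x"] by blast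
    have gap: "\<eta> \<le> h x0 - \<phi> x0" using x0(1) by (simp add: T_def)
    have max: "h y - \<phi> y \<le> h x0 - \<phi> x0" if "R \<le> norm y" for y
      using x0(2)[of y] gap that by (cases "y \<in> T") (auto simp: T_def)
    have x0R: "norm x0 > R"
    proof (rule ccontr)
      assume "\<not> norm x0 > R"
      then have "norm x0 = R" using x0(1) by (auto simp: T_def)
      then have "h x0 = \<phi> z" by (simp add: h_def c_def barrier_def exp_minus)
      moreover have "\<phi> z \<le> \<phi> x0" using \<open>norm x0 = R\<close> by (intro z) simp
      ultimately show False using gap \<eta> by simp
    qed
    define M1 where "M1 = W x0"
    define M2 where "M2 = 3 * (s (norm x0))\<^sup>2 * h x0"
    have "M1 < M2"
    proof -
      have sp: "(s (norm x0))\<^sup>2 > 0" using pos[of "norm x0"] x0R by simp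
      have "M1 \<le> 2 * (s (norm x0))\<^sup>2 * \<phi> x0" using W_le[of x0] x0R by (simp add: M1_def)
      also have "\<dots> < 2 * (s (norm x0))\<^sup>2 * h x0"
        using sp gap \<eta> by (intro mult_strict_left_mono) auto
      also have "\<dots> \<le> M2" unfolding M2_def using sp h_pos[of x0] by (intro mult_right_mono) auto
      finally show ?thesis .
    qed
    \<comment> \<open>M1 is W at x0 and M2 the lower bound for the Laplacian of h there. The
      thresholds at one third and two thirds of the way from M1 to M2 persist near x0 by continuity,
      and their order contradicts the viscosity inequality.\<close>
    define S where "S = ({x. R < norm x} \<inter> W -` {..<(2 * M1 + M2) / 3})
        \<inter> ({x. R < norm x} \<inter> (\<lambda>x. 3 * (s (norm x))\<^sup>2 * h x) -` {(M1 + 2 * M2) / 3<..})"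
    have o: "open {x :: real ^ 'n. R < norm x}" by (intro open_Collect_less continuous_intros)
    have "open S"
      unfolding S_def using o
      by (intro open_Int continuous_open_preimage continuous_intros continuous_on_subset[OF W]
          continuous_on_subset[OF sc] continuous_on_subset[OF hc]) auto
    have "(M1 + 2 * M2) / 3 \<le> (2 * M1 + M2) / 3"
    proof (rule viscosity_supersolution[OF \<phi>(1) W weak \<open>open S\<close>])
      show "x0 \<in> S" using x0R \<open>M1 < M2\<close> by (simp add: S_def M1_def[symmetric] M2_def[symmetric])
      show "continuous_on S h" by (rule continuous_on_subset[OF hc]) (auto simp: S_def)
      show "((\<lambda>t. h (y + t *\<^sub>R axis i 1)) has_real_derivative c * barrier_deriv1 J s i y) (at 0)" if "y \<in> S" for i y
        using that R unfolding h_def by (intro DERIV_cmult barrier_line_derivative J) (auto simp: S_def)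
      show "((\<lambda>t. c * barrier_deriv1 J s i (y + t *\<^sub>R axis i 1)) has_real_derivative c * barrier_deriv2 J s s' i y) (at 0)"
        if "y \<in> S" for i y
        using that R by (intro DERIV_cmult barrier_deriv1_line_derivative J s) (auto simp: S_def)
      show "\<phi> x0 - h x0 \<le> \<phi> y - h y" if "y \<in> S" for y
        using max[of y] that by (simp add: S_def)
      show "W y \<le> (2 * M1 + M2) / 3" if "y \<in> S" for y using that by (simp add: S_def)
      show "(M1 + 2 * M2) / 3 \<le> (\<Sum>i\<in>UNIV. c * barrier_deriv2 J s s' i y)" if "y \<in> S" for y
      proof -
        have y: "norm y > R" "(M1 + 2 * M2) / 3 \<le> 3 * (s (norm y))\<^sup>2 * h y" using that by (auto simp: S_def)
        have "3 * (s (norm y))\<^sup>2 * h y \<le>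
            (4 * (s (norm y))\<^sup>2 - 2 * s' (norm y) - 2 * s (norm y) * (real CARD('n) - 1) / norm y) * h y"
          using sub[of "norm y"] y(1) h_pos[of y] by (intro mult_right_mono) auto
        also have "\<dots> = (\<Sum>i\<in>UNIV. c * barrier_deriv2 J s s' i y)"
        proof -
          have "y \<noteq> 0" using y(1) R by auto
          show ?thesis
            unfolding sum_distrib_left[symmetric] sum_barrier_deriv2[OF \<open>y \<noteq> 0\<close>] h_def by (simp only: mult.left_commute)
        qed
        finally show ?thesis using y(2) by simp
      qed
    qed
    with \<open>M1 < M2\<close> show False by simp
  qed
  then show ?thesis using c by (auto simp: h_def barrier_def)
qed

subsection \<open>Rosen inequalities\<close>

theorem theorem3p1:
  fixes Q :: "real \<Rightarrow> real" and q \<phi> :: "real ^ 'n \<Rightarrow> real"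
    and m :: nat and k R d :: real
  assumes n: "CARD('n) \<ge> 3"
    and Q_pos: "\<And>r. r \<ge> 0 \<Longrightarrow> Q r > 0"
    and Q_mono: "mono_on {0..} Q"
    and Q_lower: "\<And>r. r \<ge> 0 \<Longrightarrow> r\<^sup>2 < Q r"
    and m: "m \<ge> 1" and k: "k > 1" and R: "R > 0"
    and i: "\<And>r. r > R \<Longrightarrow> Q differentiable (at r)"
    and ii: "\<And>r. r \<ge> R \<Longrightarrow> iter_ln_pos m (integral {0..r} (\<lambda>t. Q t powr (1/2)))"
    and iii: "\<And>r. r \<ge> R \<Longrightarrow>
        0 < f_log k (m - 1) (ln (Q r)) * r * Q r powr (-1/2) \<and>
        f_log k (m - 1) (ln (Q r)) * r * Q r powr (-1/2) < 1"
    and Q_deriv: "((\<lambda>r. deriv Q r * Q r powr (-3/2)) \<longlongrightarrow> 0) at_top"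
    and d: "0 < d" "d \<le> 1"
    and q_cont: "continuous_on UNIV q"
    and q_nonneg: "\<And>x. q x \<ge> 0"
    and q_lower: "\<And>x. norm x \<ge> R \<Longrightarrow>
        d * integral {0..norm x} (\<lambda>t. Q t powr (1/2))
          * f_log k (m - 1) (ln (integral {0..norm x} (\<lambda>t. Q t powr (1/2)))) \<le> q x"
    and q_upper: "\<And>x. norm x \<ge> R \<Longrightarrow> q x \<le> Q (norm x)"
    and ground: "is_ground_state q \<phi>"
  shows "\<forall>\<epsilon>>0. \<exists>\<gamma>>0. \<forall>x. - ln (\<phi> x) \<le> \<epsilon> * q x + \<gamma>"
proof -
  define J where "J r = integral {0..r} (\<lambda>t. Q t powr (1/2))" for r
  define s where "s r = sqrt (Q r)" for r
  define s' where "s' r = deriv Q r / (2 * sqrt (Q r))" for r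
  have sQ: "Q r powr (1/2) = s r" if "r \<ge> 0" for r
    using Q_pos[OF that] by (simp add: s_def powr_half_sqrt)
  have s_pos: "s r > 0" if "r \<ge> 0" for r using Q_pos[OF that] by (simp add: s_def)
  have s_sq: "(s r)\<^sup>2 = Q r" if "r \<ge> 0" for r using Q_pos[OF that] by (simp add: s_def)
  have s_ge: "r \<le> s r" if "r \<ge> 0" for r
    unfolding s_def using Q_lower[OF that] by (intro real_le_rsqrt) simp
  \<comment> \<open>Monotonicity gives integrability without any continuity of Q on [0, R].\<close>
  have int: "(\<lambda>t. Q t powr (1/2)) integrable_on {0..r}" for r
  proof (rule integrable_on_mono_on, rule mono_onI)
    fix a b assume "a \<in> {0..r}" "b \<in> {0..r}" "a \<le> b"
    then show "Q a powr (1/2) \<le> Q b powr (1/2)"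
      using mono_onD[OF Q_mono, of a b] Q_pos[of a] by (intro powr_mono2) auto
  qed
  have J_deriv: "(J has_real_derivative s r) (at r)" if r: "r > R" for r
  proof -
    have "isCont Q r" using i[OF r] by (rule differentiable_imp_continuous_within)
    moreover have "Q r > 0" using Q_pos[of r] r R by simp
    ultimately have c: "isCont (\<lambda>t. Q t powr (1/2)) r" by (intro continuous_intros) auto
    \<comment> \<open>Continuity of the integrand is known only beyond R, so the fundamental theorem
      is used in its pointwise form, at an interior point of [0, r + 1].\<close>
    have "((\<lambda>u. integral {0..u} (\<lambda>t. Q t powr (1/2))) has_vector_derivative Q r powr (1/2))
        (at r within ({0..r + 1} - {}))"
      by (rule integral_has_vector_derivative_continuous_at[OF int])
        (use r R c in \<open>auto intro: continuous_at_imp_continuous_at_within\<close>)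
    moreover have "at r within {0..r + 1} = at r" using r R by (intro at_within_Icc_at) auto
    ultimately have "(J has_vector_derivative s r) (at r)"
      using sQ[of r] r R by (simp add: J_def[abs_def])
    then show ?thesis by (simp add: has_real_derivative_iff_has_vector_derivative)
  qed
  have s_deriv: "(s has_real_derivative s' r) (at r)" if r: "r > R" for r
  proof -
    have "(Q has_real_derivative deriv Q r) (at r)"
      using i[OF r] by (simp add: DERIV_deriv_iff_real_differentiable)
    moreover have "Q r > 0" using Q_pos[of r] r R by simp
    ultimately show ?thesis
      unfolding s_def[abs_def] s'_def by (auto intro!: derivative_eq_intros simp: field_simps)
  qed
  have J_lower: "r\<^sup>2 / 2 \<le> J r" if r: "r \<ge> 0" for r
  proof -
    have "((\<lambda>x. x) has_integral (r\<^sup>2 / 2)) {0..r}" using ident_has_integral[OF r] by simp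
    moreover have "((\<lambda>t. Q t powr (1/2)) has_integral J r) {0..r}"
      unfolding J_def using int by (rule integrable_integral)
    ultimately show ?thesis
      by (rule has_integral_le) (use sQ s_ge in auto)
  qed
  obtain E where \<phi>: "continuous_on UNIV \<phi>" "\<And>x. \<phi> x > 0"
    and E: "schroedinger q (\<lambda>x. complex_of_real (\<phi> x)) (\<lambda>x. complex_of_real E * complex_of_real (\<phi> x))"
    using ground by (auto simp: is_ground_state_def)
  obtain N where N: "\<And>r. r \<ge> N \<Longrightarrow> deriv Q r * Q r powr (-3/2) < 1/2"
    using order_tendstoD(2)[OF Q_deriv, of "1/2"] by (auto simp: eventually_at_top_linorder)
  \<comment> \<open>N controls Q', R + 1 gives differentiability, 4 n tames the term with (n - 1)/r,
    |E| absorbs the energy, and 1 gives r \<le> r^2.\<close>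
  define R0 where "R0 = max N (max (R + 1) (4 * real CARD('n) + \<bar>E\<bar> + 1))"
  have R0: "N \<le> r" "R < r" "4 * real CARD('n) \<le> r" "\<bar>E\<bar> \<le> r" "1 \<le> r" if "r \<ge> R0" for r
    using that by (auto simp: R0_def)
  have rsq: "r \<le> Q r" if "r \<ge> R0" for r
  proof -
    have "r \<le> r\<^sup>2" using R0(5)[OF that] by (simp add: power2_eq_square)
    also have "\<dots> \<le> Q r" using Q_lower[of r] R0(5)[OF that] by simp
    finally show ?thesis .
  qed
  define W where "W x = (q x - E) * \<phi> x" for x
  have "\<exists>c>0. \<forall>x. norm x \<ge> R0 \<longrightarrow> c * exp (- 2 * J (norm x)) \<le> \<phi> x"
  proof (rule ground_state_lower_bound[OF \<phi>])
    show "continuous_on UNIV W" unfolding W_def by (intro continuous_intros q_cont \<phi>)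
    show "(\<Sum>i\<in>UNIV. LINT x|lborel. complex_of_real (\<phi> x) * partial i (partial i (\<lambda>x. complex_of_real (\<rho> x))) x) =
        complex_of_real (LINT x|lborel. W x * \<rho> x)"
      if "(\<lambda>x. complex_of_real (\<rho> x)) \<in> test_functions" for \<rho>
      unfolding W_def by (rule schroedinger_distributional[OF E q_cont q_nonneg \<phi>(1) that])
    show "R0 > 0" using R0(5)[of R0] by simp
    fix r assume r: "r \<ge> R0"
    note R0 = R0[OF r]
    show "(J has_real_derivative s r) (at r)" "(s has_real_derivative s' r) (at r)"
      using R0 J_deriv s_deriv by auto
    show "r\<^sup>2 / 2 \<le> J r" "s r > 0" using J_lower s_pos R0(5) by auto
    have r0: "r \<ge> 0" using R0(5) by simp
    \<comment> \<open>2 s' = Q Q' Q^(-3/2), and the last two factors multiply to less than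
      1/2.\<close>
    have "2 * s' r \<le> Q r / 2"
    proof -
      have "Q r powr (-3/2) = Q r powr (- 1) * Q r powr (- (1/2))"
        unfolding powr_add[symmetric] by simp
      also have "\<dots> = 1 / (Q r * s r)"
        unfolding powr_minus sQ[OF r0] using Q_pos[OF r0] by (simp add: field_simps)
      finally have "deriv Q r / (Q r * s r) < 1 / 2" using N[OF R0(1)] by simp
      moreover have "2 * s' r = Q r * (deriv Q r / (Q r * s r))"
        using Q_pos[OF r0] by (simp add: s'_def s_def)
      ultimately show ?thesis using Q_pos[OF r0] mult_left_mono[of "deriv Q r / (Q r * s r)" "1/2" "Q r"] by simp
    qed
    moreover have "2 * s r * (real CARD('n) - 1) / r \<le> Q r / 2"
    proof -
      \<comment> \<open>Here s(r) \<ge> r \<ge> 4 n: the growth of Q pays for the dimension.\<close>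
      have "4 * (real CARD('n) - 1) \<le> s r" using R0(3) s_ge[OF r0] by simp
      also have "\<dots> \<le> s r * r" using R0(5) s_pos[OF r0] by simp
      finally have "s r * (4 * (real CARD('n) - 1)) \<le> s r * (s r * r)"
        using s_pos[OF r0] by (intro mult_left_mono) auto
      then have "4 * s r * (real CARD('n) - 1) \<le> Q r * r"
        using s_sq[OF r0] by (simp add: power2_eq_square mult_ac)
      then show ?thesis using R0(5) by (simp add: divide_le_eq)
    qed
    ultimately show "3 * (s r)\<^sup>2 \<le> 4 * (s r)\<^sup>2 - 2 * s' r - 2 * s r * (real CARD('n) - 1) / r"
      unfolding s_sq[OF r0] by simp
  next
    fix x :: "real ^ 'n" assume x: "norm x \<ge> R0"
    \<comment> \<open>One Q bounds the potential, the other bounds -E through |E| \<le> |x| \<le>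
      Q(|x|).\<close>
    have "q x - E \<le> 2 * Q (norm x)"
      using q_upper[of x] R0(2,4)[OF x] rsq[OF x] by (simp add: abs_le_iff)
    then show "W x \<le> 2 * (s (norm x))\<^sup>2 * \<phi> x"
      unfolding W_def s_sq[OF norm_ge_zero] using \<phi>(2)[of x] by (intro mult_right_mono) auto
  qed
  then obtain c where c: "c > 0" "\<And>x. norm x \<ge> R0 \<Longrightarrow> c * exp (- 2 * J (norm x)) \<le> \<phi> x" by blast
  have J_top: "filterlim J at_top at_top"
  proof (rule filterlim_at_top_mono[OF filterlim_ident])
    show "eventually (\<lambda>r. r \<le> J r) at_top"
    proof (rule eventually_at_top_linorderI[of 2])
      fix r :: real assume "r \<ge> 2"
      then have "r \<le> r\<^sup>2 / 2" by (simp add: power2_eq_square)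
      also have "\<dots> \<le> J r" using \<open>r \<ge> 2\<close> by (intro J_lower) simp
      finally show "r \<le> J r" .
    qed
  qed
  have f_top: "filterlim (\<lambda>r. f_log k (m - 1) (ln (J r))) at_top at_top"
    using k by (intro filterlim_compose[OF f_log_at_top] filterlim_compose[OF ln_at_top] J_top) simp
  show ?thesis
  proof (intro allI impI)
    fix \<epsilon> :: real assume \<epsilon>: "\<epsilon> > 0"
    \<comment> \<open>From this radius on, \<epsilon> d f(ln J) \<ge> 2, hence 2 J \<le> \<epsilon>
      d J f(ln J) \<le> \<epsilon> q.\<close>
    obtain R1 where R1: "\<And>r. r \<ge> R1 \<Longrightarrow> 2 / (d * \<epsilon>) \<le> f_log k (m - 1) (ln (J r))"
      using f_top by (auto simp: filterlim_at_top eventually_at_top_linorder)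
    define R2 where "R2 = max R0 R1"
    have "(cball 0 R2 :: (real ^ 'n) set) \<noteq> {}" using R0(5)[of R0] by (simp add: R2_def)
    then obtain z where z: "\<And>x. x \<in> cball 0 R2 \<Longrightarrow> \<phi> z \<le> \<phi> x"
      using continuous_attains_inf[OF compact_cball _ continuous_on_subset[OF \<phi>(1) subset_UNIV]] by metis
    \<comment> \<open>The first term serves the ball, the second the constant of the exterior bound,
      and 1 makes \<gamma> positive.\<close>
    define \<gamma> where "\<gamma> = \<bar>ln (\<phi> z)\<bar> + \<bar>ln c\<bar> + 1"
    have "- ln (\<phi> x) \<le> \<epsilon> * q x + \<gamma>" for x
    proof (cases "norm x \<le> R2")
      case True
      then have "ln (\<phi> z) \<le> ln (\<phi> x)" using z[of x] \<phi>(2) by simp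
      moreover have "0 \<le> \<epsilon> * q x" using \<epsilon> q_nonneg by simp
      ultimately show ?thesis unfolding \<gamma>_def by linarith
    next
      case False
      then have x: "norm x \<ge> R0" "norm x \<ge> R1" by (auto simp: R2_def)
      have "ln (c * exp (- 2 * J (norm x))) \<le> ln (\<phi> x)"
        using c(2)[OF x(1)] c(1) by (intro ln_mono) auto
      then have 1: "- ln (\<phi> x) \<le> 2 * J (norm x) - ln c"
        using c(1) by (simp add: ln_mult)
      have J0: "J (norm x) \<ge> 0" using J_lower[OF norm_ge_zero, of x] zero_le_power2[of "norm x"] by linarith
      have "2 * J (norm x) = \<epsilon> * (d * J (norm x) * (2 / (d * \<epsilon>)))"
        using d \<epsilon> by simp
      also have "\<dots> \<le> \<epsilon> * (d * J (norm x) * f_log k (m - 1) (ln (J (norm x))))"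
        using R1[OF x(2)] J0 d \<epsilon> by (intro mult_left_mono) auto
      also have "\<dots> \<le> \<epsilon> * q x"
        using q_lower[of x] R0(2)[OF x(1)] \<epsilon> unfolding J_def by (intro mult_left_mono) auto
      finally show ?thesis using 1 unfolding \<gamma>_def by linarith
    qed
    moreover have "\<gamma> > 0" by (simp add: \<gamma>_def)
    ultimately show "\<exists>\<gamma>>0. \<forall>x. - ln (\<phi> x) \<le> \<epsilon> * q x + \<gamma>" by blast
  qed
qed

end
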